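(* Let $\mathcal U$ be a unitary channel. Then for every $m\ge1$, $$\mathcal F(\tilde{\mathbb G},\mathcal U\mathbb G\mathcal U^\dagger,m)=\frac1d+\frac{d-1}{d}\big(C(\mathcal U)p^m+D(m,\mathcal U)\big),$$ where $$C(\mathcal U)=\frac{\langle\boldsymbol\Pi_{\rm tr},\boldsymbol{\mathcal A}_\infty\boldsymbol{\mathcal U}\rangle}{\|\boldsymbol\Pi_{\rm tr}\|_F^2}\cdot\frac{\langle\boldsymbol\Pi_{\rm tr},\boldsymbol{\mathcal U}^\dagger\boldsymbol{\mathcal B}_\infty\rangle}{\|\boldsymbol\Pi_{\rm tr}\|_F^2}\cdot\frac{\|\boldsymbol\Pi_{\rm tr}\|_F^2}{\langle\boldsymbol\Pi_{\rm tr},\boldsymbol{\mathcal A}_\infty\boldsymbol{\mathcal B}_\infty\rangle}$$ (equivalently $C(\mathcal U)=\frac{\langle\boldsymbol{\mathcal A}_\infty^T,\boldsymbol{\mathcal U}\rangle}{\|\boldsymbol\Pi_{\rm tr}\|_F^2}\frac{\langle\boldsymbol{\mathcal U},\boldsymbol{\mathcal B}_\infty\rangle}{\|\boldsymbol\Pi_{\rm tr}\|_F^2}\big(\frac{\langle\boldsymbol{\mathcal A}_\infty^T,\boldsymbol{\mathcal B}_\infty\rangle}{\|\boldsymbol\Pi_{\rm tr}\|_F^2}\big)^{-1}$) and $$D(m,\mathcal U)=\sqrt{1-a(\mathcal U)^2}\sqrt{1-b(\mathcal U)^2}\;w(\mathcal U)^\dagger\boldsymbol\Delta^m v(\mathcal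 U).$$
   Context: $\mathbb G$ is a finite group of unitary channels on a $d$-dimensional system forming a unitary 2-design (as in randomized benchmarking); $\tilde{\mathbb G}=\{\tilde{\mathcal G}\}$ is its noisy implementation (CPTP maps, possibly gate-dependent), a small perturbation of $\mathbb G$. Bold symbols are real Liouville matrices (orthonormal Hermitian operator basis) of linear maps; $\Pi_{\rm tr}(\rho)=\rho-\mathbb I\operatorname{tr}\rho/d$; $\langle M_1,M_2\rangle=\operatorname{tr}(M_1^\dagger M_2)$ and $\|\cdot\|_F$ is the induced Frobenius norm. For $A=\sum_{j,k}a_{jk}e_je_k^T$, ${\rm vec}(A)=\sum_{j,k}a_{jk}e_k\otimes e_j$. Expectations are over independent uniformly random $\mathcal G_1,\dots,\mathcal G_m\in\mathbb G$; products $\mathcal X_{m:1}=\mathcal X_m\cdots\mathcal X_1$. Average fidelity: ${\rm F}(\tilde{\mathcal C},\mathcal C)=\int\operatorname{tr}[\tilde{\mathcal C}(\psi)^\dagger\mathcal C(\psi)]d\psi$ over uniformly random pure states; gate-set circuit fidelity $\mathcal F(\tilde{\mathbb G},\mathcal U\mathbb G\mathcal U^\dagger,m)=\mathbb E[{\rm F}(\tilde{\mathcal G}_{m:1},\mathcal U\mathcal G_{m:1}\mathcal U^\dagger)]$. Let $\boldsymbol{\mathcal G}_{\rm tr}=\boldsymbol{\mathcal G}\boldsymbol\Pi_{\rm tr}$, $\boldsymbol{\mathcal T}=\mathbb E[\boldsymbol{\mathcal G}_{\rm tr}\otimes\tilde{\boldsymbol{\mathcal G}}]$, and $p$ its largest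 eigenvalue. Let $\boldsymbol{\mathcal A}_\infty=\lim_m p^{-m}\mathbb E[(\boldsymbol{\mathcal G}_{{\rm tr},m:1})^\dagger\boldsymbol\Pi_{\rm tr}\tilde{\boldsymbol{\mathcal G}}_{m:1}]$ and $\boldsymbol{\mathcal B}_\infty=\lim_m p^{-m}\mathbb E[\tilde{\boldsymbol{\mathcal G}}_{m:1}\boldsymbol\Pi_{\rm tr}(\boldsymbol{\mathcal G}_{{\rm tr},m:1})^\dagger]$; ${\rm vec}^\dagger(\boldsymbol{\mathcal A}_\infty^T)$ and ${\rm vec}(\boldsymbol{\mathcal B}_\infty)$ are left and right $p$-eigenvectors of $\boldsymbol{\mathcal T}$, and $\boldsymbol\Delta:=\boldsymbol{\mathcal T}-p\,{\rm vec}(\boldsymbol{\mathcal B}_\infty){\rm vec}^\dagger(\boldsymbol{\mathcal A}_\infty^T)/\langle\boldsymbol{\mathcal A}_\infty^T,\boldsymbol{\mathcal B}_\infty\rangle$. Define $a(\mathcal U)=\frac{\langle\boldsymbol{\mathcal A}_\infty^T,\boldsymbol{\mathcal U}\rangle}{\|\boldsymbol\Pi_{\rm tr}\|_F^2}\big(\frac{\|\boldsymbol{\mathcal A}_\infty\|_F^2}{\|\boldsymbol\Pi_{\rm tr}\|_F^2}\big)^{-1/2}$, $b(\mathcal U)=\frac{\langle\boldsymbol{\mathcal U},\boldsymbol{\mathcal B}_\infty\rangle}{\|\boldsymbol\Pi_{\rm tr}\|_F^2}\big(\frac{\|\boldsymbol{\mathcal B}_\infty\|_F^2}{\|\boldsymbol\Pi_{\rm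 tr}\|_F^2}\big)^{-1/2}$, and the unit vectors $w(\mathcal U),v(\mathcal U)$ by ${\rm vec}^\dagger(\boldsymbol{\mathcal U}\boldsymbol\Pi_{\rm tr})/\|\boldsymbol\Pi_{\rm tr}\|_F=a(\mathcal U){\rm vec}^\dagger(\boldsymbol{\mathcal A}_\infty^T)/\|\boldsymbol{\mathcal A}_\infty\|_F+\sqrt{1-a(\mathcal U)^2}\,w(\mathcal U)^\dagger$ and ${\rm vec}(\boldsymbol{\mathcal U}\boldsymbol\Pi_{\rm tr})/\|\boldsymbol\Pi_{\rm tr}\|_F=b(\mathcal U){\rm vec}(\boldsymbol{\mathcal B}_\infty)/\|\boldsymbol{\mathcal B}_\infty\|_F+\sqrt{1-b(\mathcal U)^2}\,v(\mathcal U)$. *)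

theory Defs
  imports "HOL-Analysis.Analysis" "HOL-Probability.Probability"
begin

definition adj :: "complex^('d::finite)^('d::finite) \<Rightarrow> complex^('d::finite)^('d::finite)" where
  "adj M = (\<chi> i j. cnj (M $ j $ i))"

definition hs :: "complex^('d::finite)^('d::finite) \<Rightarrow> complex^('d::finite)^('d::finite) \<Rightarrow> complex" where
  "hs A B = trace (adj A ** B)"

definition unitary_mat :: "complex^('d::finite)^('d::finite) \<Rightarrow> bool" where
  "unitary_mat V \<longleftrightarrow> adj V ** V = mat 1"

definition uchan :: "complex^('d::finite)^('d::finite) \<Rightarrow> (complex^('d::finite)^('d::finite) \<Rightarrow> complex^('d::finite)^('d::finite))" where
  "uchan V = (\<lambda>\<rho>. V ** \<rho> ** adj V)"

definition unitary_channel :: "(complex^('d::finite)^('d::finite) \<Rightarrow> complex^('d::finite)^('d::finite)) \<Rightarrow> bool" where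
  "unitary_channel \<Phi> \<longleftrightarrow> (\<exists>V. unitary_mat V \<and> \<Phi> = uchan V)"

definition completely_positive :: "(complex^('d::finite)^('d::finite) \<Rightarrow> complex^('d::finite)^('d::finite)) \<Rightarrow> bool" where
  "completely_positive \<Phi> \<longleftrightarrow>
     (\<exists>Ks :: (complex^('d::finite)^('d::finite)) list. \<forall>\<rho>. \<Phi> \<rho> = (\<Sum>K\<leftarrow>Ks. K ** \<rho> ** adj K))"

definition trace_preserving :: "(complex^('d::finite)^('d::finite) \<Rightarrow> complex^('d::finite)^('d::finite)) \<Rightarrow> bool" where
  "trace_preserving \<Phi> \<longleftrightarrow> (\<forall>\<rho>. trace (\<Phi> \<rho>) = trace \<rho>)"

definition cptp :: "(complex^('d::finite)^('d::finite) \<Rightarrow> complex^('d::finite)^('d::finite)) \<Rightarrow> bool" where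
  "cptp \<Phi> \<longleftrightarrow> completely_positive \<Phi> \<and> trace_preserving \<Phi>"

definition Pi_tr :: "complex^('d::finite)^('d::finite) \<Rightarrow> complex^('d::finite)^('d::finite)" where
  "Pi_tr \<rho> = \<rho> - mat (trace \<rho> / of_nat CARD('d))"

definition finite_channel_group :: "(complex^('d::finite)^('d::finite) \<Rightarrow> complex^('d::finite)^('d::finite)) set \<Rightarrow> bool" where
  "finite_channel_group G \<longleftrightarrow> finite G \<and> id \<in> G \<and> (\<forall>g\<in>G. \<forall>h\<in>G. g \<circ> h \<in> G)
      \<and> (\<forall>g\<in>G. unitary_channel g)"

definition rep_unitary :: "(complex^('d::finite)^('d::finite) \<Rightarrow> complex^('d::finite)^('d::finite)) \<Rightarrow> complex^('d::finite)^('d::finite)" where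
  "rep_unitary g = (SOME V. unitary_mat V \<and> g = uchan V)"

definition ckron :: "complex^('d::finite)^('d::finite) \<Rightarrow> complex^('d::finite)^('d::finite) \<Rightarrow> complex^('d::finite\<times>'d::finite)^('d::finite\<times>'d::finite)" where
  "ckron A B = (\<chi> p q. A $ fst p $ fst q * B $ snd p $ snd q)"

definition swap_op :: "complex^('d::finite\<times>'d::finite)^('d::finite\<times>'d::finite)" where
  "swap_op = (\<chi> p q. if fst p = snd q \<and> snd p = fst q then 1 else 0)"

definition cscale :: "complex \<Rightarrow> complex^('n::finite)^('m::finite) \<Rightarrow> complex^('n::finite)^('m::finite)" where
  "cscale c M = (\<chi> i j. c * M $ i $ j)"

text \<open>Unitary 2-design: the group average of (U \<otimes> U) X (U \<otimes> U)^dagger equals the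
  Haar average, which is  (tr X - tr(F X)/d)/(d^2-1) I + (tr(F X) - tr X/d)/(d^2-1) F
  (F the swap); written multiplied through by d^2-1.  The expression is independent of the
  global phase of the representing unitary.\<close>
definition unitary_2design :: "(complex^('d::finite)^('d::finite) \<Rightarrow> complex^('d::finite)^('d::finite)) set \<Rightarrow> bool" where
  "unitary_2design G \<longleftrightarrow> (\<forall>g\<in>G. unitary_channel g) \<and>
     (\<forall>X :: complex^('d::finite\<times>'d::finite)^('d::finite\<times>'d::finite).
        let d = (of_nat CARD('d) :: complex) in
        cscale ((d^2 - 1) / of_nat (card G))
          (\<Sum>g\<in>G. ckron (rep_unitary g) (rep_unitary g) ** X **
                     adj (ckron (rep_unitary g) (rep_unitary g)))
        = mat (trace X - trace (swap_op ** X) / d)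
          + cscale (trace (swap_op ** X) - trace X / d) swap_op)"

definition herm_onb :: "('b::finite \<Rightarrow> complex^('d::finite)^('d::finite)) \<Rightarrow> bool" where
  "herm_onb E \<longleftrightarrow> CARD('b) = CARD('d)^2 \<and> (\<forall>i. adj (E i) = E i)
      \<and> (\<forall>i j. hs (E i) (E j) = (if i = j then 1 else 0))"

definition liou :: "('b::finite \<Rightarrow> complex^('d::finite)^('d::finite)) \<Rightarrow> (complex^('d::finite)^('d::finite) \<Rightarrow> complex^('d::finite)^('d::finite)) \<Rightarrow> real^('b::finite)^('b::finite)" where
  "liou E \<Phi> = (\<chi> i j. Re (hs (E i) (\<Phi> (E j))))"

definition fro_inner :: "real^('n::finite)^('m::finite) \<Rightarrow> real^('n::finite)^('m::finite) \<Rightarrow> real" where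
  "fro_inner A B = trace (transpose A ** B)"

definition fro_norm :: "real^('n::finite)^('m::finite) \<Rightarrow> real" where
  "fro_norm A = sqrt (fro_inner A A)"

definition kron :: "real^('n::finite)^('n::finite) \<Rightarrow> real^('k::finite)^('k::finite) \<Rightarrow> real^('n\<times>'k)^('n\<times>'k)" where
  "kron A B = (\<chi> p q. A $ fst p $ fst q * B $ snd p $ snd q)"

definition vecm :: "real^('n::finite)^('n::finite) \<Rightarrow> real^('n\<times>'n)" where
  "vecm A = (\<chi> p. A $ snd p $ fst p)"

definition outer :: "real^('n::finite) \<Rightarrow> real^('n::finite) \<Rightarrow> real^('n::finite)^('n::finite)" where
  "outer x y = (\<chi> i j. x $ i * y $ j)"

fun mpow :: "real^('n::finite)^('n::finite) \<Rightarrow> nat \<Rightarrow> real^('n::finite)^('n::finite)" where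
  "mpow A 0 = mat 1"
| "mpow A (Suc k) = A ** mpow A k"

fun mprod :: "(real^('n::finite)^('n::finite)) list \<Rightarrow> real^('n::finite)^('n::finite)" where
  "mprod [] = mat 1"
| "mprod (X # Xs) = mprod Xs ** X"

fun cprod :: "('a \<Rightarrow> 'a) list \<Rightarrow> 'a \<Rightarrow> 'a" where
  "cprod [] = id"
| "cprod (f # fs) = cprod fs \<circ> f"

definition is_eigenvalue :: "real^('n::finite)^('n::finite) \<Rightarrow> complex \<Rightarrow> bool" where
  "is_eigenvalue T l \<longleftrightarrow> (\<exists>v :: complex^'n. v \<noteq> 0 \<and>
      (\<chi> i j. complex_of_real (T $ i $ j)) *v v = l *s v)"

definition largest_eigenvalue :: "real^('n::finite)^('n::finite) \<Rightarrow> real \<Rightarrow> bool" where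
  "largest_eigenvalue T p \<longleftrightarrow> is_eigenvalue T (complex_of_real p)
      \<and> (\<forall>l. is_eigenvalue T l \<longrightarrow> cmod l \<le> p)"

definition seqs :: "'g set \<Rightarrow> nat \<Rightarrow> 'g list set" where
  "seqs G m = {gs. length gs = m \<and> set gs \<subseteq> G}"

definition expect :: "'g set \<Rightarrow> nat \<Rightarrow> ('g list \<Rightarrow> 'v::real_vector) \<Rightarrow> 'v" where
  "expect G m f = (1 / real (card G ^ m)) *\<^sub>R (\<Sum>gs\<in>seqs G m. f gs)"

type_synonym 'd chan = "complex^'d^'d \<Rightarrow> complex^'d^'d"

definition Ltr :: "('b::finite \<Rightarrow> complex^('d::finite)^('d::finite)) \<Rightarrow> ('d::finite) chan \<Rightarrow> real^('b::finite)^('b::finite)" where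
  "Ltr E g = liou E g ** liou E Pi_tr"

definition Tmat :: "('b::finite \<Rightarrow> complex^('d::finite)^('d::finite)) \<Rightarrow> ('d::finite) chan set \<Rightarrow> (('d::finite) chan \<Rightarrow> ('d::finite) chan)
     \<Rightarrow> real^('b::finite\<times>'b::finite)^('b::finite\<times>'b::finite)" where
  "Tmat E G Gt = expect G 1 (\<lambda>gs. kron (Ltr E (hd gs)) (liou E (Gt (hd gs))))"

definition Amat :: "('b::finite \<Rightarrow> complex^('d::finite)^('d::finite)) \<Rightarrow> ('d::finite) chan set \<Rightarrow> (('d::finite) chan \<Rightarrow> ('d::finite) chan)
     \<Rightarrow> nat \<Rightarrow> real^('b::finite)^('b::finite)" where
  "Amat E G Gt m = expect G m (\<lambda>gs. transpose (mprod (map (Ltr E) gs)) ** liou E Pi_tr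
                                     ** mprod (map (\<lambda>g. liou E (Gt g)) gs))"

definition Bmat :: "('b::finite \<Rightarrow> complex^('d::finite)^('d::finite)) \<Rightarrow> ('d::finite) chan set \<Rightarrow> (('d::finite) chan \<Rightarrow> ('d::finite) chan)
     \<Rightarrow> nat \<Rightarrow> real^('b::finite)^('b::finite)" where
  "Bmat E G Gt m = expect G m (\<lambda>gs. mprod (map (\<lambda>g. liou E (Gt g)) gs) ** liou E Pi_tr
                                     ** transpose (mprod (map (Ltr E) gs)))"

text \<open>Uniformly random pure states psi = |x><x|/|x|^2, x a standard complex Gaussian
  vector in C^d (its normalisation is Haar/unitarily-invariant distributed).\<close>
definition gauss :: "(complex^'d) measure" where
  "gauss = density lborel (\<lambda>x. ennreal (exp (- (norm x * norm x)) / pi ^ CARD('d)))"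

definition pure_state :: "complex^'d \<Rightarrow> complex^('d::finite)^('d::finite)" where
  "pure_state x = (\<chi> i j. x $ i * cnj (x $ j) / complex_of_real ((norm x)^2))"

definition avg_fidelity :: "('d::finite) chan \<Rightarrow> ('d::finite) chan \<Rightarrow> complex" where
  "avg_fidelity \<Phi> \<Psi> = (\<integral>x. trace (adj (\<Phi> (pure_state x)) ** \<Psi> (pure_state x)) \<partial>gauss)"

definition circuit_fidelity :: "('d::finite) chan set \<Rightarrow> (('d::finite) chan \<Rightarrow> ('d::finite) chan) \<Rightarrow> complex^('d::finite)^('d::finite) \<Rightarrow> nat \<Rightarrow> complex" where
  "circuit_fidelity G Gt V m = expect G m (\<lambda>gs.
      avg_fidelity (cprod (map Gt gs)) (uchan V \<circ> cprod gs \<circ> uchan (adj V)))"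

definition Ccoef :: "('b::finite \<Rightarrow> complex^('d::finite)^('d::finite)) \<Rightarrow> real^('b::finite)^('b::finite) \<Rightarrow> real^('b::finite)^('b::finite) \<Rightarrow> complex^('d::finite)^('d::finite) \<Rightarrow> real" where
  "Ccoef E A B V = (let LU = liou E (uchan V); n2 = (fro_norm (liou E Pi_tr))^2 in
      (fro_inner (transpose A) LU / n2) * (fro_inner LU B / n2)
        * inverse (fro_inner (transpose A) B / n2))"

definition acoef :: "('b::finite \<Rightarrow> complex^('d::finite)^('d::finite)) \<Rightarrow> real^('b::finite)^('b::finite) \<Rightarrow> complex^('d::finite)^('d::finite) \<Rightarrow> real" where
  "acoef E A V = (let LU = liou E (uchan V); n2 = (fro_norm (liou E Pi_tr))^2 in
      (fro_inner (transpose A) LU / n2) * inverse (sqrt ((fro_norm A)^2 / n2)))"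

definition bcoef :: "('b::finite \<Rightarrow> complex^('d::finite)^('d::finite)) \<Rightarrow> real^('b::finite)^('b::finite) \<Rightarrow> complex^('d::finite)^('d::finite) \<Rightarrow> real" where
  "bcoef E B V = (let LU = liou E (uchan V); n2 = (fro_norm (liou E Pi_tr))^2 in
      (fro_inner LU B / n2) * inverse (sqrt ((fro_norm B)^2 / n2)))"

text \<open>w, v solved from
  vec(U Pi)/|Pi| = a vec(A^T)/|A| + sqrt(1-a^2) w,  vec(U Pi)/|Pi| = b vec(B)/|B| + sqrt(1-b^2) v.\<close>
definition wvec :: "('b::finite \<Rightarrow> complex^('d::finite)^('d::finite)) \<Rightarrow> real^('b::finite)^('b::finite) \<Rightarrow> complex^('d::finite)^('d::finite) \<Rightarrow> real^('b::finite\<times>'b::finite)" where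
  "wvec E A V = (let P = liou E Pi_tr; LU = liou E (uchan V); a = acoef E A V in
      inverse (sqrt (1 - a^2)) *\<^sub>R
        ((1 / fro_norm P) *\<^sub>R vecm (LU ** P) - (a / fro_norm A) *\<^sub>R vecm (transpose A)))"

definition vvec :: "('b::finite \<Rightarrow> complex^('d::finite)^('d::finite)) \<Rightarrow> real^('b::finite)^('b::finite) \<Rightarrow> complex^('d::finite)^('d::finite) \<Rightarrow> real^('b::finite\<times>'b::finite)" where
  "vvec E B V = (let P = liou E Pi_tr; LU = liou E (uchan V); b = bcoef E B V in
      inverse (sqrt (1 - b^2)) *\<^sub>R
        ((1 / fro_norm P) *\<^sub>R vecm (LU ** P) - (b / fro_norm B) *\<^sub>R vecm B))"

definition Delta :: "real^('b::finite\<times>'b::finite)^('b::finite\<times>'b::finite) \<Rightarrow> real \<Rightarrow> real^('b::finite)^('b::finite) \<Rightarrow> real^('b::finite)^('b::finite) \<Rightarrow> real^('b::finite\<times>'b::finite)^('b::finite\<times>'b::finite)" where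
  "Delta T p A B = T - (p / fro_inner (transpose A) B) *\<^sub>R outer (vecm B) (vecm (transpose A))"

definition Dterm :: "('b::finite \<Rightarrow> complex^('d::finite)^('d::finite)) \<Rightarrow> real^('b::finite\<times>'b::finite)^('b::finite\<times>'b::finite) \<Rightarrow> real
     \<Rightarrow> real^('b::finite)^('b::finite) \<Rightarrow> real^('b::finite)^('b::finite) \<Rightarrow> nat \<Rightarrow> complex^('d::finite)^('d::finite) \<Rightarrow> real" where
  "Dterm E T p A B m V = sqrt (1 - (acoef E A V)^2) * sqrt (1 - (bcoef E B V)^2)
      * (wvec E A V \<bullet> (mpow (Delta T p A B) m *v vvec E B V))"

end

(* With P the Liouville matrix of Pi_tr, the second moment of a random pure state turns the average
   fidelity of Phi and a unital Psi into 1/d + <Phi, Psi P> / (d (d + 1)). By the column-stacking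
   identity (C (x) B) vec X = vec (B X C^T), averaging over random circuits gives the fidelity as the
   matrix element x . T^m x of T between copies of x = vec (U P). The limits defining A and B
   make vec (A^T) and vec B left and right p-eigenvectors, so T^m splits into p^m times a rank-one
   projection plus Delta^m, and Delta^m kills the components of x along the eigenvectors.

   The fourth moments of x / |x| for a complex Gaussian x are found by symmetry: coordinate phases
   kill the unpaired moments, a 45 degree rotation of two coordinates relates the two kinds
   of paired moments, and these sum to 1. *)

theory Submission
  imports Defs
begin

text \<open>\<open>P\<close> commutes with the Liouville matrix of every unitary channel. So the
  conjugation by U can be moved off the ideal circuit and onto the vector vec (U P): one T serves
  all U. The squared length of this vector is d^2 - 1, and d^2 - 1 over d (d + 1) is the prefactor
  (d - 1) / d.

  The eigenvector equations come from the limits alone. B_k is the orbit of vec P under T^k, and A_k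
  represents the functional that maps y to vec P . T^k y. One more application of T shifts k by one,
  which the normalisation p^(-k) turns into a factor p.

  T contains projected gates, whereas the fidelity contains unprojected ones. Products of the two
  kinds agree only next to a factor \<open>P\<close> (the empty product is the identity in both), so
  each comparison must keep such a factor at hand.

  Three degenerate cases need care: p = 0, d = 1 (where \<open>P\<close> vanishes) and a^2 = 1 or
  b^2 = 1 (where w or v is not determined by its equation). The first two contradict the nonzero
  overlap of A^T and B; the third is settled by \<open>inverse 0 = 0\<close>.\<close>

section \<open>Fourth moments of a uniformly random unit vector\<close>

text \<open>The uniqueness argument for Haar measure, tested against the unit ball B, which T preserves:
  by translation invariance and Fubini, vol B * vol (T^-1 A) = vol B * vol A.\<close>

lemma distr_lborel_orthogonal:
  fixes T :: "'a::euclidean_space \<Rightarrow> 'a"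
  assumes T: "orthogonal_transformation T"
  shows "distr lborel borel T = lborel"
proof (rule measure_eqI)
  fix A :: "'a set" assume "A \<in> sets (distr lborel borel T)"
  then have A[measurable]: "A \<in> sets borel" by simp
  define S where "S = inv T"
  have S: "orthogonal_transformation S"
    unfolding S_def by (rule orthogonal_transformation_inv[OF T])
  have lin: "linear T" "linear S" using T S by (auto simp: orthogonal_transformation)
  have TS: "T (S x) = x" for x
    unfolding S_def using orthogonal_transformation_surj[OF T] by (simp add: surj_f_inv_f)
  have TM[measurable]: "T \<in> borel \<rightarrow>\<^sub>M borel"
    by (intro borel_measurable_continuous_onI linear_continuous_on linear_conv_bounded_linear[THEN iffD1] lin)
  define B :: "'a set" where "B = ball 0 1"
  have B[measurable]: "B \<in> sets borel" by (simp add: B_def)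
  have ball: "emeasure lborel (ball (z::'a) 1) = emeasure lborel B" for z :: 'a
  proof -
    have "emeasure lborel (ball z 1) = emeasure (distr lborel borel ((+) z)) (ball z 1)"
      by (simp add: lborel_distr_plus)
    also have "\<dots> = emeasure lborel ((+) z -` ball z 1)"
      by (subst emeasure_distr) auto
    also have "(+) z -` ball z 1 = B"
      by (auto simp: B_def dist_norm)
    finally show ?thesis .
  qed
  have shift: "(\<integral>\<^sup>+y. f y \<partial>lborel) = (\<integral>\<^sup>+y. f (z + y) \<partial>lborel)"
    if [measurable]: "f \<in> borel_measurable borel" for f and z :: 'a
    by (subst (1) lborel_distr_plus[of z, symmetric], subst nn_integral_distr) auto
  have "emeasure lborel B * emeasure (distr lborel borel T) A
      = (\<integral>\<^sup>+x. indicator B x * (\<integral>\<^sup>+y. indicator A (T y) \<partial>lborel) \<partial>lborel)"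
  proof -
    have "emeasure (distr lborel borel T) A = (\<integral>\<^sup>+y. indicator A (T y) \<partial>lborel)"
      by (subst nn_integral_indicator[symmetric], simp, subst nn_integral_distr) auto
    then show ?thesis by (subst nn_integral_multc) auto
  qed
  \<comment> \<open>Translating by \<open>S x\<close> turns \<open>T y\<close> into
    \<open>x + T y\<close>. This couples the two variables, so that exchanging the integrals becomes
    useful.\<close>
  also have "\<dots> = (\<integral>\<^sup>+x. (\<integral>\<^sup>+y. indicator B x * indicator A (x + T y) \<partial>lborel) \<partial>lborel)"
  proof (rule nn_integral_cong)
    fix x :: 'a
    have "(\<integral>\<^sup>+y. indicator A (T y) \<partial>lborel) = (\<integral>\<^sup>+y. indicator A (T (S x + y)) \<partial>lborel)"
      by (rule shift) measurable
    then show "indicator B x * (\<integral>\<^sup>+y. indicator A (T y) \<partial>lborel)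
      = (\<integral>\<^sup>+y. indicator B x * indicator A (x + T y) \<partial>lborel)"
      by (simp add: linear_add[OF lin(1)] TS nn_integral_cmult)
  qed
  also have "\<dots> = (\<integral>\<^sup>+y. (\<integral>\<^sup>+x. indicator B x * indicator A (x + T y) \<partial>lborel) \<partial>lborel)"
    by (rule lborel_pair.Fubini') measurable
  also have "\<dots> = (\<integral>\<^sup>+y. (\<integral>\<^sup>+x. indicator B (x - T y) * indicator A x \<partial>lborel) \<partial>lborel)"
  proof (rule nn_integral_cong)
    fix y :: 'a
    show "(\<integral>\<^sup>+x. indicator B x * indicator A (x + T y) \<partial>lborel)
      = (\<integral>\<^sup>+x. indicator B (x - T y) * indicator A x \<partial>lborel)"
      using shift[of "\<lambda>x. indicator B (x - T y) * indicator A x" "T y"]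
      by (simp add: add.commute)
  qed
  also have "\<dots> = (\<integral>\<^sup>+x. (\<integral>\<^sup>+y. indicator B (x - T y) * indicator A x \<partial>lborel) \<partial>lborel)"
    by (rule lborel_pair.Fubini') measurable
  also have "\<dots> = (\<integral>\<^sup>+x. emeasure lborel B * indicator A x \<partial>lborel)"
  proof (rule nn_integral_cong)
    fix x :: 'a
    \<comment> \<open>Here isometry enters: the slice in \<open>y\<close> is again a unit ball, and
      the volume of a ball does not depend on its centre.\<close>
    have "x - T y \<in> B \<longleftrightarrow> y \<in> ball (S x) 1" for y
    proof -
      have "norm (x - T y) = norm (T (S x - y))"
        by (simp add: linear_diff[OF lin(1)] TS)
      also have "\<dots> = norm (S x - y)"
        using T by (simp add: orthogonal_transformation)
      finally show ?thesis by (simp add: B_def dist_norm norm_minus_commute)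
    qed
    then have "(\<integral>\<^sup>+y. indicator B (x - T y) * indicator A x \<partial>lborel)
      = (\<integral>\<^sup>+y. indicator (ball (S x) 1) y * indicator A x \<partial>lborel)"
      by (simp add: indicator_def)
    also have "\<dots> = emeasure lborel B * indicator A x"
      by (subst nn_integral_multc) (auto simp: ball intro!: borel_measurable_indicator)
    finally show "(\<integral>\<^sup>+y. indicator B (x - T y) * indicator A x \<partial>lborel)
      = emeasure lborel B * indicator A x" .
  qed
  also have "\<dots> = emeasure lborel B * emeasure lborel A"
    by (subst nn_integral_cmult) auto
  finally have eq: "emeasure lborel B * emeasure (distr lborel borel T) A
    = emeasure lborel B * emeasure lborel A" .
  have "emeasure lborel B \<noteq> \<infinity>"
    unfolding B_def using emeasure_lborel_ball_finite[of "0::'a" 1] by auto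
  moreover have "emeasure lborel B \<noteq> 0"
    unfolding B_def using open_not_negligible[of "ball (0::'a) 1"]
    by (auto simp: negligible_iff_null_sets null_sets_def null_sets_completion_iff)
  ultimately show "emeasure (distr lborel borel T) A = emeasure lborel A"
    using eq by (simp add: ennreal_mult_cancel_left)
qed simp

section \<open>The complex Gaussian measure and its orthogonal invariance\<close>

lemma nn_integral_exp_neg_square:
  "(\<integral>\<^sup>+x. ennreal (exp (- x\<^sup>2)) \<partial>lborel) = ennreal (sqrt pi)"
proof -
  have "exp (- x\<^sup>2) = sqrt pi * normal_density 0 (1 / sqrt 2) x" for x :: real
    by (simp add: normal_density_def power_divide)
  then have "(\<integral>\<^sup>+x. ennreal (exp (- x\<^sup>2)) \<partial>lborel)
     = (\<integral>\<^sup>+x. ennreal (sqrt pi) * ennreal (normal_density 0 (1 / sqrt 2) x) \<partial>lborel)"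
    by (simp add: ennreal_mult)
  also have "\<dots> = ennreal (sqrt pi) * (\<integral>\<^sup>+x. ennreal (normal_density 0 (1 / sqrt 2) x) \<partial>lborel)"
    by (rule nn_integral_cmult) simp
  also have "(\<integral>\<^sup>+x. ennreal (normal_density 0 (1 / sqrt 2) x) \<partial>lborel) = 1"
    by (subst nn_integral_eq_integral) auto
  finally show ?thesis by simp
qed

text \<open>The density factors over the \<open>2 * CARD('d)\<close> real coordinates, each of which
  contributes \<open>sqrt pi\<close>. This explains the constant \<open>pi ^ CARD('d)\<close> in
  \<open>gauss\<close>.\<close>

lemma prob_space_gauss: "prob_space (gauss :: (complex^'d::finite) measure)"
proof (rule prob_spaceI)
  have "(\<integral>\<^sup>+(x::complex^'d). ennreal (exp (- (norm x * norm x))) \<partial>lborel)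
    = (\<integral>\<^sup>+(x::complex^'d). (\<Prod>b\<in>Basis. ennreal (exp (- (x \<bullet> b)\<^sup>2))) \<partial>lborel)"
  proof (rule nn_integral_cong)
    fix x :: "complex^'d"
    have "norm x * norm x = (\<Sum>b\<in>Basis. (x \<bullet> b)\<^sup>2)"
      by (subst power2_eq_square[symmetric], subst power2_norm_eq_inner, subst euclidean_inner)
        (simp add: power2_eq_square)
    then show "ennreal (exp (- (norm x * norm x))) = (\<Prod>b\<in>Basis. ennreal (exp (- (x \<bullet> b)\<^sup>2)))"
      by (simp add: exp_sum sum_negf[symmetric] prod_ennreal)
  qed
  also have "\<dots> = (\<Prod>b\<in>(Basis :: (complex^'d) set). ennreal (sqrt pi))"
    by (subst nn_integral_lborel_prod) (auto simp: nn_integral_exp_neg_square)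
  also have "\<dots> = ennreal (pi ^ CARD('d))"
  proof -
    have "sqrt pi ^ (CARD('d) * 2) = pi ^ CARD('d)"
      by (simp add: mult.commute[of _ 2] power_mult)
    then show ?thesis by (simp add: ennreal_power)
  qed
  finally have I: "(\<integral>\<^sup>+(x::complex^'d). ennreal (exp (- (norm x * norm x))) \<partial>lborel) = ennreal (pi ^ CARD('d))" .
  have "emeasure (gauss :: (complex^'d) measure) (space gauss)
     = (\<integral>\<^sup>+(x::complex^'d). ennreal (1 / pi ^ CARD('d)) * ennreal (exp (- (norm x * norm x))) \<partial>lborel)"
    unfolding gauss_def
    by (subst emeasure_density) (auto simp: ennreal_mult[symmetric] intro!: nn_integral_cong)
  also have "\<dots> = ennreal (1 / pi ^ CARD('d)) * ennreal (pi ^ CARD('d))"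
    by (subst nn_integral_cmult) (auto simp: I)
  also have "\<dots> = 1"
    by (simp add: ennreal_mult[symmetric])
  finally show "emeasure (gauss :: (complex^'d) measure) (space gauss) = 1" .
qed

text \<open>Lebesgue measure and the density, a function of the norm, are both invariant under
  \<open>T\<close>.\<close>

lemma integral_gauss_orthogonal:
  fixes f :: "complex^'d \<Rightarrow> 'b::{banach, second_countable_topology}"
    and T :: "complex^'d \<Rightarrow> complex^'d"
  assumes T: "orthogonal_transformation T" and f[measurable]: "f \<in> borel_measurable borel"
  shows "(\<integral>x. f (T x) \<partial>gauss) = (\<integral>x. f x \<partial>gauss)"
proof -
  have TM[measurable]: "T \<in> borel \<rightarrow>\<^sub>M borel"
    using T by (intro borel_measurable_continuous_onI linear_continuous_on
        linear_conv_bounded_linear[THEN iffD1]) (auto simp: orthogonal_transformation)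
  let ?h = "\<lambda>x::complex^'d. exp (- (norm x * norm x)) / pi ^ CARD('d)"
  have "(\<integral>x. f x \<partial>gauss) = (\<integral>x. ?h x *\<^sub>R f x \<partial>lborel)"
    unfolding gauss_def by (subst integral_density) auto
  also have "\<dots> = (\<integral>x. ?h x *\<^sub>R f x \<partial>distr lborel borel T)"
    by (simp only: distr_lborel_orthogonal[OF T])
  also have "\<dots> = (\<integral>x. ?h (T x) *\<^sub>R f (T x) \<partial>lborel)"
    by (subst integral_distr) auto
  also have "\<dots> = (\<integral>x. ?h x *\<^sub>R f (T x) \<partial>lborel)"
    using T by (simp add: orthogonal_transformation)
  also have "\<dots> = (\<integral>x. f (T x) \<partial>gauss)"
    unfolding gauss_def by (subst integral_density) auto
  finally show ?thesis by simp
qed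

lemma orthogonal_transformation_phase:
  fixes u :: "'d::finite \<Rightarrow> complex"
  assumes "\<And>k. cmod (u k) = 1"
  shows "orthogonal_transformation (\<lambda>x::complex^'d. \<chi> k. u k * x $ k)"
  unfolding orthogonal_transformation
proof (intro conjI allI)
  show "linear (\<lambda>x::complex^'d. \<chi> k. u k * x $ k)"
    by (rule linearI) (auto simp: vec_eq_iff algebra_simps)
  show "norm (\<chi> k. u k * x $ k) = norm x" for x :: "complex^'d"
    by (simp add: norm_vec_def norm_mult assms)
qed

text \<open>\<open>iso\<close> asks for an isometry of the plane of two complex coordinates. It is
  applied to the 45 degree rotation and to the exchange of the coordinates.\<close>

lemma orthogonal_transformation_plane:
  fixes \<alpha> \<beta> \<gamma> \<delta> :: complex and a b :: "'d::finite"
  assumes "a \<noteq> b"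
    and iso: "\<And>u v. (cmod (\<alpha> * u + \<beta> * v))\<^sup>2 + (cmod (\<gamma> * u + \<delta> * v))\<^sup>2 = (cmod u)\<^sup>2 + (cmod v)\<^sup>2"
  shows "orthogonal_transformation (\<lambda>x::complex^'d. \<chi> k.
    if k = a then \<alpha> * x $ a + \<beta> * x $ b else if k = b then \<gamma> * x $ a + \<delta> * x $ b else x $ k)"
    (is "orthogonal_transformation ?T")
  unfolding orthogonal_transformation
proof (intro conjI allI)
  show "linear ?T"
    by (rule linearI) (auto simp: vec_eq_iff algebra_simps)
  fix x :: "complex^'d"
  have split: "(\<Sum>k\<in>UNIV. h k) = h a + h b + (\<Sum>k\<in>UNIV - {a} - {b}. h k)" for h :: "'d \<Rightarrow> real"
    using \<open>a \<noteq> b\<close> by (simp add: sum.remove[of UNIV a] sum.remove[of "UNIV - {a}" b])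
  show "norm (?T x) = norm x"
    using \<open>a \<noteq> b\<close> iso[of "x $ a" "x $ b"]
    by (simp add: norm_vec_def L2_set_def split)
qed

text \<open>The conjugates sit on \<open>i\<close> and \<open>l\<close> so that this is the product
  of the conjugated \<open>i\<close>, \<open>j\<close> entry and the \<open>k\<close>,
  \<open>l\<close> entry of \<open>pure_state x\<close>.\<close>

definition gauss_moment_fun :: "'d \<Rightarrow> 'd \<Rightarrow> 'd \<Rightarrow> 'd \<Rightarrow> complex^'d::finite \<Rightarrow> complex" where
  "gauss_moment_fun i j k l x = cnj (x $ i) * x $ j * (x $ k * cnj (x $ l)) / of_real (norm x ^ 4)"

definition gauss_moment :: "'d \<Rightarrow> 'd \<Rightarrow> 'd \<Rightarrow> 'd::finite \<Rightarrow> complex" where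
  "gauss_moment i j k l = (\<integral>x. gauss_moment_fun i j k l x \<partial>gauss)"

lemma borel_measurable_gauss_moment_fun[measurable]:
  "gauss_moment_fun i j k l \<in> borel_measurable borel"
proof -
  have [measurable]: "(\<lambda>x::complex^'a. x $ i) \<in> borel_measurable borel" for i
    by (intro borel_measurable_continuous_onI continuous_intros)
  have [measurable]: "(\<lambda>x::complex^'a. cnj (x $ i)) \<in> borel_measurable borel" for i
    by (intro borel_measurable_continuous_onI continuous_intros)
  show ?thesis unfolding gauss_moment_fun_def by measurable
qed

lemma integrable_gauss_moment_fun:
  "integrable gauss (gauss_moment_fun i j k l)"
proof -
  interpret prob_space "gauss :: (complex^'a) measure" by (rule prob_space_gauss)
  have "norm (gauss_moment_fun i j k l x) \<le> 1" for x :: "complex^'a"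
  proof (cases "x = 0")
    case False
    have "cmod (x $ i) * cmod (x $ j) * (cmod (x $ k) * cmod (x $ l))
      \<le> norm x * norm x * (norm x * norm x)"
      by (intro mult_mono Finite_Cartesian_Product.norm_nth_le mult_nonneg_nonneg norm_ge_zero)
    then show ?thesis
      using False
      by (simp add: gauss_moment_fun_def norm_mult norm_divide norm_power divide_le_eq power4_eq_xxxx mult.assoc)
  qed (simp add: gauss_moment_fun_def)
  moreover have "gauss_moment_fun i j k l \<in> borel_measurable (gauss :: (complex^'a) measure)"
    by (simp add: gauss_def)
  ultimately show ?thesis
    by (intro integrable_const_bound[of _ 1]) auto
qed

lemma gauss_moment_orthogonal:
  fixes T :: "complex^'d \<Rightarrow> complex^'d"
  assumes "orthogonal_transformation T"
  shows "gauss_moment i j k l = (\<integral>x. gauss_moment_fun i j k l (T x) \<partial>gauss)"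
  unfolding gauss_moment_def by (rule integral_gauss_orthogonal[symmetric, OF assms]) simp

text \<open>A phase \<i> on coordinate \<open>a\<close> multiplies the moment by \<i> to the power
  e, where e counts \<open>a\<close> among \<open>j\<close>, \<open>k\<close> minus \<open>a\<close>
  among \<open>i\<close>, \<open>l\<close>. Since e lies between -2 and 2, the factor is 1 only for
  e = 0; a sign -1 in place of \<i> would miss e = 2 and e = -2. If e = 0 for both
  \<open>a = i\<close> and \<open>a = l\<close>, the indices are paired.\<close>

lemma gauss_moment_eq_0:
  fixes i j k l :: "'d::finite"
  assumes "\<not> ((i = j \<and> k = l) \<or> (i = k \<and> j = l))"
  shows "gauss_moment i j k l = 0"
proof -
  have phase: "(c - 1) * gauss_moment i j k l = 0"
    if "u = (\<lambda>k. if k = a then \<i> else 1)" "c = cnj (u i) * u j * (u k * cnj (u l))"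
    for a :: 'd and u :: "'d \<Rightarrow> complex" and c
  proof -
    have T: "orthogonal_transformation (\<lambda>x::complex^'d. \<chi> k. u k * x $ k)"
      by (rule orthogonal_transformation_phase) (simp add: that)
    have "gauss_moment_fun i j k l (\<chi> k. u k * x $ k) = c * gauss_moment_fun i j k l x" for x
    proof -
      have "norm (\<chi> k. u k * x $ k) = norm x"
        using T by (simp add: orthogonal_transformation)
      then show ?thesis by (simp add: gauss_moment_fun_def that(2))
    qed
    then have "gauss_moment i j k l = c * gauss_moment i j k l"
      by (subst gauss_moment_orthogonal[OF T]) (simp add: gauss_moment_def)
    then show ?thesis by (simp add: algebra_simps)
  qed
  have "1 + \<i> \<noteq> 0" "\<i> \<noteq> -1" "-\<i> - 1 \<noteq> 0" by (auto simp: complex_eq_iff)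
  then show ?thesis
    using phase[OF refl refl, of i] phase[OF refl refl, of l] assms
    by (auto split: if_splits)
qed

text \<open>The rotation of the coordinates a, b by 45 degrees.\<close>

lemma gauss_moment_rotate:
  fixes a b :: "'d::finite"
  assumes "a \<noteq> b"
  shows "gauss_moment a a b b = (gauss_moment a a a a + gauss_moment b b b b) / 4"
proof -
  define s :: complex where "s = of_real (1 / sqrt 2)"
  have s2: "s * s = 1/2" by (simp add: s_def flip: of_real_mult)
  have s_cnj: "cnj s = s" by (simp add: s_def)
  have iso: "(cmod (s * u + s * v))\<^sup>2 + (cmod (s * u + (- s) * v))\<^sup>2 = (cmod u)\<^sup>2 + (cmod v)\<^sup>2" for u v
  proof -
    have "complex_of_real ((cmod (s * u + s * v))\<^sup>2 + (cmod (s * u + (- s) * v))\<^sup>2)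
      = 2 * (s * s) * (u * cnj u + v * cnj v)"
      unfolding of_real_add complex_norm_square by (simp add: s_cnj algebra_simps)
    also have "\<dots> = of_real ((cmod u)\<^sup>2 + (cmod v)\<^sup>2)"
      unfolding s2 of_real_add complex_norm_square by simp
    finally show ?thesis by (simp only: of_real_eq_iff)
  qed
  define T :: "complex^'d \<Rightarrow> complex^'d" where "T = (\<lambda>x. \<chi> k. if k = a then s * x $ a + s * x $ b
      else if k = b then s * x $ a + (- s) * x $ b else x $ k)"
  have T: "orthogonal_transformation T"
    unfolding T_def by (rule orthogonal_transformation_plane[OF assms iso])
  have eq: "gauss_moment_fun a a b b (T x) = (gauss_moment_fun a a a a x - gauss_moment_fun a b b a x
      - gauss_moment_fun b a a b x + gauss_moment_fun b b b b x) / 4" for x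
  proof -
    have nT: "norm (T x) = norm x" using T by (simp add: orthogonal_transformation)
    have Ta: "T x $ a = s * (x $ a + x $ b)" and Tb: "T x $ b = s * (x $ a - x $ b)"
      using assms by (auto simp: T_def algebra_simps)
    \<comment> \<open>Collecting conjugated and plain factors separately yields differences of
      squares. The only mixed terms are then of the form cnj (x_a)^2 x_b^2, which are unpaired, so
      no paired mixed moment returns on the right.\<close>
    have "cnj (T x $ a) * T x $ a * (T x $ b * cnj (T x $ b))
      = (s * s) * (s * s) * (((cnj (x $ a))\<^sup>2 - (cnj (x $ b))\<^sup>2) * ((x $ a)\<^sup>2 - (x $ b)\<^sup>2))"
      unfolding Ta Tb by (simp add: s_cnj power2_eq_square algebra_simps)
    also have "\<dots> = ((cnj (x $ a))\<^sup>2 - (cnj (x $ b))\<^sup>2) * ((x $ a)\<^sup>2 - (x $ b)\<^sup>2) / 4"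
      by (simp add: s2)
    finally have "gauss_moment_fun a a b b (T x)
      = ((cnj (x $ a))\<^sup>2 - (cnj (x $ b))\<^sup>2) * ((x $ a)\<^sup>2 - (x $ b)\<^sup>2) / 4 / of_real (norm x ^ 4)"
      unfolding gauss_moment_fun_def nT by (simp only:)
    then show ?thesis
      by (simp add: gauss_moment_fun_def power2_eq_square algebra_simps add_divide_distrib diff_divide_distrib)
  qed
  have "gauss_moment a a b b = (gauss_moment a a a a - gauss_moment a b b a
      - gauss_moment b a a b + gauss_moment b b b b) / 4"
    by (subst gauss_moment_orthogonal[OF T]) (simp add: eq gauss_moment_def integrable_gauss_moment_fun)
  then show ?thesis
    using assms by (simp add: gauss_moment_eq_0)
qed

lemma gauss_moment_swap:
  fixes a b :: "'d::finite"
  shows "gauss_moment a a a a = gauss_moment b b b b"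
proof (cases "a = b")
  case False
  define T :: "complex^'d \<Rightarrow> complex^'d" where "T = (\<lambda>x. \<chi> k. if k = a then 0 * x $ a + 1 * x $ b
      else if k = b then 1 * x $ a + 0 * x $ b else x $ k)"
  have T: "orthogonal_transformation T"
    unfolding T_def by (rule orthogonal_transformation_plane[OF False]) simp
  have "gauss_moment_fun a a a a (T x) = gauss_moment_fun b b b b x" for x
  proof -
    have "norm (T x) = norm x" using T by (simp add: orthogonal_transformation)
    then show ?thesis by (simp add: gauss_moment_fun_def) (simp add: T_def)
  qed
  then show ?thesis
    by (subst gauss_moment_orthogonal[OF T]) (simp add: gauss_moment_def)
qed simp

lemma gauss_moment_sum:
  "(\<Sum>a\<in>UNIV. \<Sum>b\<in>UNIV. gauss_moment a a b (b::'d::finite)) = 1"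
proof -
  interpret prob_space "gauss :: (complex^'d) measure" by (rule prob_space_gauss)
  have one: "(\<Sum>a\<in>UNIV. \<Sum>b\<in>UNIV. gauss_moment_fun a a b b x) = 1" if "x \<noteq> 0" for x :: "complex^'d"
  proof -
    have "complex_of_real ((norm x)\<^sup>2) = (\<Sum>a\<in>UNIV. of_real ((cmod (x $ a))\<^sup>2))"
      by (simp add: norm_vec_def L2_set_def sum_nonneg)
    also have "\<dots> = (\<Sum>a\<in>UNIV. cnj (x $ a) * x $ a)"
      by (simp only: complex_norm_square mult.commute)
    finally have n: "(\<Sum>a\<in>UNIV. cnj (x $ a) * x $ a) = complex_of_real ((norm x)\<^sup>2)" ..
    have "(\<Sum>a\<in>UNIV. \<Sum>b\<in>UNIV. gauss_moment_fun a a b b x)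
      = (\<Sum>a\<in>UNIV. cnj (x $ a) * x $ a) * (\<Sum>b\<in>UNIV. cnj (x $ b) * x $ b) / of_real (norm x ^ 4)"
      by (simp add: gauss_moment_fun_def sum_product sum_divide_distrib mult_ac)
    also have "\<dots> = 1"
      unfolding n using that by (simp add: power2_eq_square power4_eq_xxxx)
    finally show ?thesis .
  qed
  \<comment> \<open>The origin has to be set aside: division by zero makes the integrand 0 there
    instead of 1.\<close>
  have "AE x in (gauss :: (complex^'d) measure). x \<noteq> 0"
    unfolding gauss_def by (subst AE_density) (auto intro: AE_mp[OF AE_lborel_singleton[of 0]])
  then have ae: "AE x in (gauss :: (complex^'d) measure). (\<Sum>a\<in>UNIV. \<Sum>b\<in>UNIV. gauss_moment_fun a a b b x) = 1"
    by eventually_elim (rule one)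
  have "(\<Sum>a\<in>UNIV. \<Sum>b\<in>UNIV. gauss_moment a a b (b::'d))
     = (\<integral>x. (\<Sum>a\<in>UNIV. \<Sum>b\<in>UNIV. gauss_moment_fun a a b b x) \<partial>(gauss :: (complex^'d) measure))"
    by (simp add: gauss_moment_def integrable_gauss_moment_fun)
  also have "\<dots> = (\<integral>x. 1 \<partial>(gauss :: (complex^'d) measure))"
    by (rule integral_cong_AE) (auto simp: ae gauss_def)
  finally show ?thesis by (simp add: prob_space)
qed

lemma gauss_moment_eq:
  fixes i j k l :: "'d::finite"
  shows "gauss_moment i j k l =
    ((if i = j \<and> k = l then 1 else 0) + (if i = k \<and> j = l then 1 else 0))
      / (of_nat CARD('d) * (of_nat CARD('d) + 1))"
proof -
  \<comment> \<open>\<open>c\<close> is the paired moment of two distinct coordinates. Reading it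
    off the diagonal moment keeps it meaningful when there is only one coordinate. The total is then
    d c + d^2 c = 1.\<close>
  define c :: complex where "c = gauss_moment i i i i / 2"
  have diag: "gauss_moment a a a a = 2 * c" for a :: 'd
    unfolding c_def using gauss_moment_swap[of a i] by simp
  have pair: "gauss_moment a a b b = (if a = b then c else 0) + c" for a b :: 'd
    using gauss_moment_rotate[of a b] by (auto simp: diag)
  have "(\<Sum>a\<in>UNIV. \<Sum>b\<in>UNIV. (if a = (b::'d) then c else 0) + c) = 1"
    using gauss_moment_sum[where 'd='d] by (simp add: pair)
  then have "c * (of_nat CARD('d) * (of_nat CARD('d) + 1)) = 1"
    by (simp add: sum.distrib algebra_simps)
  then have c: "c = 1 / (of_nat CARD('d) * (of_nat CARD('d) + 1))"
    by (metis mult_zero_right nonzero_eq_divide_eq zero_neq_one)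
  have pair': "gauss_moment a b a b = gauss_moment a a b b" for a b :: 'd
    by (simp add: gauss_moment_def gauss_moment_fun_def mult_ac)
  show ?thesis
  proof (cases "(i = j \<and> k = l) \<or> (i = k \<and> j = l)")
    case True
    then show ?thesis by (auto simp: pair pair' diag c[symmetric]) (auto simp: c)
  next
    case False
    show ?thesis by (subst gauss_moment_eq_0) (use False in auto)
  qed
qed

section \<open>Liouville matrices and average fidelity\<close>

lemma hs_sum: "hs A B = (\<Sum>i\<in>UNIV. \<Sum>j\<in>UNIV. cnj (A $ i $ j) * B $ i $ j)"
  unfolding hs_def trace_def adj_def matrix_matrix_mult_def
  by simp (rule sum.swap)

lemma cnj_hs: "cnj (hs A B) = hs B A"
  by (simp add: hs_sum mult.commute)

lemma hs_add_right: "hs A (B + C) = hs A B + hs A C"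
  by (simp add: hs_sum sum.distrib algebra_simps)

lemma hs_diff_right: "hs A (B - C) = hs A B - hs A C"
  by (simp add: hs_sum sum_subtractf algebra_simps)

lemma hs_cscale_right: "hs A (cscale c B) = c * hs A B"
  by (simp add: hs_sum cscale_def sum_distrib_left mult_ac)

lemma hs_cscale_left: "hs (cscale c A) B = cnj c * hs A B"
  by (metis cnj_hs complex_cnj_mult hs_cscale_right)

lemma hs_sum_right: "hs A (\<Sum>b\<in>S. f b) = (\<Sum>b\<in>S. hs A (f b))"
proof -
  have "hs A 0 = 0" by (simp add: hs_sum)
  then show ?thesis
    by (induction S rule: infinite_finite_induct) (simp_all add: hs_add_right)
qed

lemma hs_sum_left: "hs (\<Sum>b\<in>S. f b) A = (\<Sum>b\<in>S. hs (f b) A)"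
  using hs_sum_right[of A f S] by (subst (1 2) cnj_hs[symmetric]) simp

lemma adj_adj [simp]: "adj (adj A) = A"
  by (simp add: adj_def vec_eq_iff)

lemma adj_matrix_mul: "adj (A ** B) = adj B ** adj A"
  by (simp add: adj_def matrix_matrix_mult_def vec_eq_iff mult.commute)

lemma adj_add: "adj (A + B) = adj A + adj B"
  by (simp add: adj_def vec_eq_iff)

lemma trace_adj: "trace (adj A) = cnj (trace A)"
  by (simp add: trace_def adj_def)

lemma hs_mat_1: "hs A (mat 1) = cnj (trace A)"
  by (simp add: hs_def trace_adj)

lemma mat_eq_cscale: "(mat c :: complex^'d^'d::finite) = cscale c (mat 1)"
  by (auto simp: mat_def cscale_def vec_eq_iff)

lemma trace_cscale: "trace (cscale c A) = c * trace A"
  by (simp add: trace_def cscale_def sum_distrib_left)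

lemma cscale_mult: "cscale c A ** B = cscale c (A ** B)" "A ** cscale c B = cscale c (A ** B)"
  by (simp_all add: cscale_def matrix_matrix_mult_def vec_eq_iff sum_distrib_left mult_ac)

lemma matrix_add_left_distrib: "(A + B) ** C = A ** C + B ** (C :: complex^'n^'m::finite)"
  by (simp add: matrix_matrix_mult_def vec_eq_iff sum.distrib algebra_simps)

lemma unitary_mat_adj: "unitary_mat V \<Longrightarrow> unitary_mat (adj V)"
  by (simp add: unitary_mat_def matrix_left_right_inverse)

text \<open>Hermiticity-preserving linear maps: those whose Liouville matrix is real, so that taking real
  parts in the definition of the Liouville matrix loses nothing.\<close>

definition hp_linear :: "('d::finite) chan \<Rightarrow> bool" where
  "hp_linear \<Phi> \<longleftrightarrow> (\<forall>A B. \<Phi> (A + B) = \<Phi> A + \<Phi> B) \<and> (\<forall>c A. \<Phi> (cscale c A) = cscale c (\<Phi> A))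
     \<and> (\<forall>A. adj (\<Phi> A) = \<Phi> (adj A))"

lemma hp_linear_id: "hp_linear id"
  by (simp add: hp_linear_def)

lemma hp_linear_comp: "hp_linear \<Phi> \<Longrightarrow> hp_linear \<Psi> \<Longrightarrow> hp_linear (\<Phi> \<circ> \<Psi>)"
  by (simp add: hp_linear_def)

lemma hp_linear_cprod: "\<forall>f\<in>set fs. hp_linear f \<Longrightarrow> hp_linear (cprod fs)"
  by (induction fs) (auto intro: hp_linear_id hp_linear_comp)

lemma hp_linear_conj: "hp_linear (\<lambda>\<rho>. K ** \<rho> ** adj K)"
  unfolding hp_linear_def
  by (simp add: adj_matrix_mul matrix_add_ldistrib matrix_add_left_distrib cscale_mult matrix_mul_assoc)

lemma hp_linear_uchan: "hp_linear (uchan V)"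
  unfolding uchan_def by (rule hp_linear_conj)

lemma hp_linear_cptp:
  assumes "cptp \<Phi>"
  shows "hp_linear \<Phi>"
proof -
  obtain Ks where Ks: "\<Phi> = (\<lambda>\<rho>. \<Sum>K\<leftarrow>Ks. K ** \<rho> ** adj K)"
    using assms unfolding cptp_def completely_positive_def by blast
  have "hp_linear (\<lambda>\<rho>. \<Sum>K\<leftarrow>Ks. K ** \<rho> ** adj K)"
  proof (induction Ks)
    case Nil
    show ?case by (simp add: hp_linear_def cscale_def adj_def vec_eq_iff)
  next
    case (Cons K Ks)
    then show ?case
      using hp_linear_conj[of K] unfolding hp_linear_def
      by (auto simp: adj_add) (simp add: cscale_def vec_eq_iff algebra_simps)
  qed
  then show ?thesis by (simp add: Ks)
qed

lemma hp_linear_Pi_tr: "hp_linear (Pi_tr :: 'd::finite chan)"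
  unfolding hp_linear_def
proof (intro conjI allI)
  fix A B :: "complex^'d^'d" and c
  show "Pi_tr (A + B) = Pi_tr A + Pi_tr B"
    by (simp add: Pi_tr_def trace_add vec_eq_iff mat_def add_divide_distrib)
  show "Pi_tr (cscale c A) = cscale c (Pi_tr A)"
    by (simp add: Pi_tr_def trace_cscale) (simp add: cscale_def vec_eq_iff mat_def right_diff_distrib)
  show "adj (Pi_tr A) = Pi_tr (adj A)"
    by (simp add: Pi_tr_def trace_adj) (simp add: adj_def vec_eq_iff mat_def)
qed

lemma hp_linear_sum:
  assumes "hp_linear \<Phi>"
  shows "\<Phi> (\<Sum>b\<in>S. f b) = (\<Sum>b\<in>S. \<Phi> (f b))"
proof -
  have "cscale 0 A = 0" for A :: "complex^'a^'a" by (simp add: cscale_def vec_eq_iff)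
  with assms have "\<Phi> 0 = 0" unfolding hp_linear_def by metis
  then show ?thesis
    using assms by (induction S rule: infinite_finite_induct) (auto simp: hp_linear_def)
qed

section \<open>Unitary channels and the projection \<open>Pi_tr\<close>\<close>

lemma unitary_channel_mat:
  assumes "unitary_channel g"
  shows "g (mat c) = mat c"
proof -
  obtain V where V: "unitary_mat V" "g = uchan V"
    using assms by (auto simp: unitary_channel_def)
  have "V ** adj V = mat 1"
    using V(1) by (simp add: unitary_mat_def matrix_left_right_inverse)
  then show ?thesis
    by (subst (1 2) mat_eq_cscale) (simp add: V uchan_def cscale_mult)
qed

lemma unitary_channel_trace:
  assumes "unitary_channel g"
  shows "trace (g A) = trace A"
proof -
  obtain V where V: "unitary_mat V" "g = uchan V"
    using assms by (auto simp: unitary_channel_def)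
  have "trace (V ** A ** adj V) = trace (adj V ** V ** A)"
    by (subst trace_mul_sym) (simp add: matrix_mul_assoc)
  then show ?thesis using V by (simp add: uchan_def unitary_mat_def)
qed

lemma hp_linear_unitary_channel: "unitary_channel g \<Longrightarrow> hp_linear g"
  by (auto simp: unitary_channel_def hp_linear_uchan)

lemma unitary_channel_uchan: "unitary_mat V \<Longrightarrow> unitary_channel (uchan V)"
  by (auto simp: unitary_channel_def)

lemma hp_linear_diff:
  assumes "hp_linear \<Phi>"
  shows "\<Phi> (A - B) = \<Phi> A - \<Phi> B"
  using assms unfolding hp_linear_def by (metis add_diff_cancel diff_add_cancel)

lemma Pi_tr_unitary_channel:
  assumes "unitary_channel g"
  shows "Pi_tr \<circ> g = g \<circ> Pi_tr"
  using assms
  by (simp add: fun_eq_iff Pi_tr_def unitary_channel_trace hp_linear_diff hp_linear_unitary_channel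
      unitary_channel_mat)

lemma trace_mat: "trace (mat c :: complex^'d^'d::finite) = of_nat CARD('d) * c"
  by (simp add: trace_def mat_def)

lemma Pi_tr_idem: "Pi_tr \<circ> Pi_tr = Pi_tr"
proof -
  have "mat 0 = (0 :: complex^'a^'a)" by (simp add: mat_def vec_eq_iff)
  then show ?thesis by (simp add: fun_eq_iff Pi_tr_def trace_sub trace_mat)
qed

lemma hs_Pi_tr: "hs A (Pi_tr B) = hs (Pi_tr A) B"
proof -
  have 1: "hs A (Pi_tr B) = hs A B - cnj (trace A) * trace B / of_nat CARD('a)" for A B :: "complex^'a^'a"
    unfolding Pi_tr_def
    by (subst mat_eq_cscale) (simp add: hs_diff_right hs_cscale_right hs_mat_1)
  show ?thesis
    by (subst (2) cnj_hs[symmetric]) (simp add: 1 cnj_hs)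
qed

lemma hs_uchan: "hs A (uchan V B) = hs (uchan (adj V) A) B"
  unfolding hs_def uchan_def
  by (simp add: adj_matrix_mul matrix_mul_assoc)
    (subst trace_mul_sym, simp add: matrix_mul_assoc)

lemma cprod_unitary_channel:
  assumes "\<forall>g\<in>set gs. unitary_channel g"
  shows "hp_linear (cprod gs)" "cprod gs (mat c) = mat c"
proof -
  show "hp_linear (cprod gs)"
    using assms by (intro hp_linear_cprod) (simp add: hp_linear_unitary_channel)
  show "cprod gs (mat c) = mat c"
    using assms by (induction gs) (auto simp: unitary_channel_mat)
qed

lemma cprod_cptp:
  assumes "\<forall>f\<in>set fs. cptp f"
  shows "hp_linear (cprod fs)" "trace (cprod fs A) = trace A"
proof -
  show "hp_linear (cprod fs)"
    using assms by (intro hp_linear_cprod) (simp add: hp_linear_cptp)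
  show "trace (cprod fs A) = trace A"
    using assms by (induction fs arbitrary: A) (auto simp: cptp_def trace_preserving_def)
qed

section \<open>Liouville matrices in a Hermitian orthonormal basis\<close>

locale hermitian_basis =
  fixes E :: "'b::finite \<Rightarrow> complex^'d::finite^'d"
  assumes onb: "herm_onb E"
begin

lemma adj_E: "adj (E i) = E i"
  and hs_E: "hs (E i) (E j) = (if i = j then 1 else 0)"
  and card_E: "CARD('b) = CARD('d)\<^sup>2"
  using onb by (auto simp: herm_onb_def)

text \<open>Orthonormality says that the square matrix of entries of the basis, with the index sets
  identified by a bijection, has a left inverse; completeness says that this is a right inverse.\<close>

lemma completeness:
  "(\<Sum>b\<in>UNIV. E b $ i $ j * cnj (E b $ k $ l)) = (if i = k \<and> j = l then 1 else 0)"
proof -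
  have "card (UNIV :: 'b set) = card (UNIV :: ('d \<times> 'd) set)"
    by (simp add: card_E power2_eq_square card_prod)
  then obtain f :: "'b \<Rightarrow> 'd \<times> 'd" where f: "bij f"
    using finite_same_card_bij[of "UNIV :: 'b set" "UNIV :: ('d \<times> 'd) set"] by auto
  define M N :: "complex^'b^'b" where
    "M = (\<chi> b c. cnj (E b $ fst (f c) $ snd (f c)))" and
    "N = (\<chi> c b. E b $ fst (f c) $ snd (f c))"
  have "(\<Sum>c\<in>UNIV. cnj (E a $ fst (f c) $ snd (f c)) * E b $ fst (f c) $ snd (f c)) = hs (E a) (E b)" for a b
  proof -
    have "(\<Sum>c\<in>UNIV. cnj (E a $ fst (f c) $ snd (f c)) * E b $ fst (f c) $ snd (f c))
      = (\<Sum>p\<in>UNIV. cnj (E a $ fst p $ snd p) * E b $ fst p $ snd p)"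
      by (rule sum.reindex_bij_betw[OF f])
    also have "\<dots> = hs (E a) (E b)"
      by (simp add: hs_sum sum.cartesian_product case_prod_beta)
    finally show ?thesis .
  qed
  then have "M ** N = mat 1"
    by (simp add: M_def N_def matrix_matrix_mult_def mat_def vec_eq_iff hs_E)
  then have "N ** M = mat 1"
    by (simp add: matrix_left_right_inverse)
  then have NM: "(N ** M) $ inv f (i, j) $ inv f (k, l) = (mat 1 :: complex^'b^'b) $ inv f (i, j) $ inv f (k, l)"
    by simp
  have "f (inv f p) = p" for p
    using f by (simp add: bij_is_surj surj_f_inv_f)
  moreover have "inv f p = inv f q \<longleftrightarrow> p = q" for p q
    using f by (metis bij_is_surj surj_f_inv_f)
  ultimately show ?thesis
    using NM by (simp add: M_def N_def matrix_matrix_mult_def mat_def)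
qed

lemma expansion: "A = (\<Sum>b\<in>UNIV. cscale (hs (E b) A) (E b))"
proof -
  have "(\<Sum>b\<in>UNIV. cscale (hs (E b) A) (E b)) $ i $ j = A $ i $ j" for i j
  proof -
    have "(\<Sum>b\<in>UNIV. cscale (hs (E b) A) (E b)) $ i $ j
       = (\<Sum>b\<in>UNIV. \<Sum>k\<in>UNIV. \<Sum>l\<in>UNIV. A $ k $ l * (E b $ i $ j * cnj (E b $ k $ l)))"
      by (simp add: sum_component cscale_def hs_sum sum_distrib_left mult_ac)
    also have "\<dots> = (\<Sum>k\<in>UNIV. \<Sum>l\<in>UNIV. A $ k $ l * (\<Sum>b\<in>UNIV. E b $ i $ j * cnj (E b $ k $ l)))"
      unfolding sum_distrib_left by (subst sum.swap, intro sum.cong refl sum.swap)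
    also have "\<dots> = (\<Sum>k\<in>UNIV. \<Sum>l\<in>UNIV. if i = k \<and> j = l then A $ k $ l else 0)"
      by (intro sum.cong refl) (simp add: completeness)
    also have "\<dots> = (\<Sum>k\<in>UNIV. if i = k then A $ k $ j else 0)"
      by (intro sum.cong refl) auto
    finally show ?thesis by simp
  qed
  then show ?thesis by (simp add: vec_eq_iff)
qed

lemma hp_linear_expansion:
  assumes "hp_linear \<Phi>"
  shows "\<Phi> A = (\<Sum>b\<in>UNIV. cscale (hs (E b) A) (\<Phi> (E b)))"
  using assms by (subst expansion[of A], subst hp_linear_sum[OF assms]) (simp add: hp_linear_def)

lemma hs_expansion:
  assumes "hp_linear \<Phi>" "hp_linear \<Psi>"
  shows "hs (\<Phi> A) (\<Psi> B)
    = (\<Sum>b\<in>UNIV. \<Sum>c\<in>UNIV. cnj (hs (E b) A) * hs (E c) B * hs (\<Phi> (E b)) (\<Psi> (E c)))"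
  unfolding hp_linear_expansion[OF assms(1), of A] hp_linear_expansion[OF assms(2), of B]
  by (simp add: hs_sum_left hs_sum_right hs_cscale_left hs_cscale_right sum_distrib_left mult_ac)
    (rule sum.swap)

lemma parseval: "hs A B = (\<Sum>b\<in>UNIV. cnj (hs (E b) A) * hs (E b) B)"
  by (subst expansion[of B]) (simp add: hs_sum_right hs_cscale_right cnj_hs mult.commute)

text \<open>\<open>E i\<close> and \<open>\<Phi> (E j)\<close> are Hermitian, so their overlap
  equals its own conjugate. Real identities between Liouville matrices are obtained from complex
  ones through this equation.\<close>

lemma of_real_liou:
  assumes "hp_linear \<Phi>"
  shows "complex_of_real (liou E \<Phi> $ i $ j) = hs (E i) (\<Phi> (E j))"
proof -
  have a: "adj (\<Phi> (E j)) = \<Phi> (E j)" using assms by (simp add: hp_linear_def adj_E)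
  have "cnj (hs (E i) (\<Phi> (E j))) = trace (\<Phi> (E j) ** E i)"
    by (simp add: cnj_hs) (simp add: hs_def a)
  also have "\<dots> = hs (E i) (\<Phi> (E j))"
    by (subst trace_mul_sym) (simp add: hs_def adj_E)
  finally show ?thesis by (simp add: liou_def complex_eq_iff)
qed

lemma liou_id: "liou E id = mat 1"
  by (auto simp: liou_def hs_E mat_def vec_eq_iff)

lemma liou_comp:
  assumes "hp_linear \<Phi>" "hp_linear \<Psi>"
  shows "liou E (\<Phi> \<circ> \<Psi>) = liou E \<Phi> ** liou E \<Psi>"
proof -
  have "liou E (\<Phi> \<circ> \<Psi>) $ i $ j = (liou E \<Phi> ** liou E \<Psi>) $ i $ j" for i j
  proof -
    have "complex_of_real (liou E (\<Phi> \<circ> \<Psi>) $ i $ j) = hs (E i) (\<Phi> (\<Psi> (E j)))"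
      by (simp add: of_real_liou hp_linear_comp assms)
    also have "\<dots> = (\<Sum>c\<in>UNIV. hs (E i) (\<Phi> (E c)) * hs (E c) (\<Psi> (E j)))"
      by (subst hp_linear_expansion[OF assms(1)]) (simp add: hs_sum_right hs_cscale_right mult.commute)
    also have "\<dots> = complex_of_real ((liou E \<Phi> ** liou E \<Psi>) $ i $ j)"
      by (simp add: matrix_matrix_mult_def of_real_liou assms)
    finally show ?thesis by (simp only: of_real_eq_iff)
  qed
  then show ?thesis by (simp add: vec_eq_iff)
qed

lemma transpose_liou:
  assumes "\<And>A B. hs A (\<Phi> B) = hs (\<Phi>' A) B"
  shows "transpose (liou E \<Phi>) = liou E \<Phi>'"
proof -
  have "Re (hs (E i) (\<Phi> (E j))) = Re (hs (E j) (\<Phi>' (E i)))" for i j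
    unfolding assms by (subst cnj_hs[symmetric]) simp
  then show ?thesis by (simp add: transpose_def liou_def vec_eq_iff)
qed

lemma fro_inner_liou:
  assumes "hp_linear \<Phi>" "hp_linear \<Psi>"
  shows "complex_of_real (fro_inner (liou E \<Phi>) (liou E \<Psi>)) = (\<Sum>b\<in>UNIV. hs (\<Phi> (E b)) (\<Psi> (E b)))"
  by (subst parseval)
    (simp add: fro_inner_def trace_def transpose_def matrix_matrix_mult_def of_real_liou[OF assms(1), symmetric]
      of_real_liou[OF assms(2), symmetric])

text \<open>Removing the trace part of \<open>E b\<close> costs the squared modulus of its trace
  over d, because \<open>\<Psi>\<close> fixes multiples of the identity and \<open>\<Phi>\<close>
  keeps traces. By Parseval for the identity matrix these costs add up to d / d = 1.\<close>

lemma fro_inner_liou_Pi_tr: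
  assumes "hp_linear \<Phi>" "\<And>A. trace (\<Phi> A) = trace A"
    and "hp_linear \<Psi>" "\<And>c. \<Psi> (mat c) = mat c"
  shows "complex_of_real (fro_inner (liou E \<Phi>) (liou E \<Psi> ** liou E Pi_tr))
    = (\<Sum>b\<in>UNIV. hs (\<Phi> (E b)) (\<Psi> (E b))) - 1"
proof -
  have "hs (\<Phi> (E b)) (\<Psi> (Pi_tr (E b)))
     = hs (\<Phi> (E b)) (\<Psi> (E b)) - cnj (hs (E b) (mat 1)) * hs (E b) (mat 1) / of_nat CARD('d)" for b
  proof -
    have "\<Psi> (Pi_tr (E b)) = \<Psi> (E b) - cscale (trace (E b) / of_nat CARD('d)) (mat 1)"
      by (simp add: Pi_tr_def hp_linear_diff[OF assms(3)] assms(4) flip: mat_eq_cscale)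
    then show ?thesis
      by (simp add: hs_diff_right hs_cscale_right hs_mat_1 assms(2))
  qed
  moreover have "(\<Sum>b\<in>UNIV. cnj (hs (E b) (mat 1)) * hs (E b) (mat 1)) = of_nat CARD('d)"
    by (simp only: parseval[symmetric]) (simp add: hs_mat_1 trace_mat)
  ultimately show ?thesis
    by (simp add: liou_comp[symmetric] fro_inner_liou hp_linear_comp assms hp_linear_Pi_tr
        sum_subtractf flip: sum_divide_distrib)
qed

text \<open>In the basis \<open>E\<close> this says that the mean of psi (x) psi is (I + F) / (d (d
  + 1)), F the swap. The pairing \<open>i = j\<close>, \<open>k = l\<close> produces the traces, the
  pairing \<open>i = k\<close>, \<open>j = l\<close> the overlap of \<open>E b\<close> and
  \<open>E c\<close>.\<close>

lemma integral_pure_state: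
  "(\<integral>x. cnj (hs (E b) (pure_state x)) * hs (E c) (pure_state x) \<partial>gauss)
    = (cnj (hs (E b) (mat 1)) * hs (E c) (mat 1) + (if b = c then 1 else 0))
       / (of_nat CARD('d) * (of_nat CARD('d) + 1))"
  and integrable_pure_state:
  "integrable gauss (\<lambda>x. cnj (hs (E b) (pure_state x)) * hs (E c) (pure_state x))"
proof -
  have eq: "cnj (hs (E b) (pure_state x)) * hs (E c) (pure_state x)
    = (\<Sum>i\<in>UNIV. \<Sum>j\<in>UNIV. \<Sum>k\<in>UNIV. \<Sum>l\<in>UNIV. E b $ i $ j * cnj (E c $ k $ l) * gauss_moment_fun i j k l x)" for x
  proof -
    have "E b $ i $ j * cnj (pure_state x $ i $ j) * (cnj (E c $ k $ l) * pure_state x $ k $ l)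
      = E b $ i $ j * cnj (E c $ k $ l) * gauss_moment_fun i j k l x" for i j k l
      by (simp add: pure_state_def gauss_moment_fun_def power2_eq_square power4_eq_xxxx mult_ac)
    moreover have "cnj (hs (E b) (pure_state x)) * hs (E c) (pure_state x) =
      (\<Sum>i\<in>UNIV. \<Sum>j\<in>UNIV. \<Sum>k\<in>UNIV. \<Sum>l\<in>UNIV. E b $ i $ j * cnj (pure_state x $ i $ j) * (cnj (E c $ k $ l) * pure_state x $ k $ l))"
      by (simp only: hs_sum cnj_sum complex_cnj_mult complex_cnj_cnj sum_distrib_left[symmetric] sum_distrib_right[symmetric])
    ultimately show ?thesis by (simp only:)
  qed
  show "integrable gauss (\<lambda>x. cnj (hs (E b) (pure_state x)) * hs (E c) (pure_state x))"
    unfolding eq by (intro Bochner_Integration.integrable_sum integrable_mult_right integrable_gauss_moment_fun)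
  have "(\<integral>x. cnj (hs (E b) (pure_state x)) * hs (E c) (pure_state x) \<partial>gauss)
    = (\<Sum>i\<in>UNIV. \<Sum>j\<in>UNIV. \<Sum>k\<in>UNIV. \<Sum>l\<in>UNIV. E b $ i $ j * cnj (E c $ k $ l) * gauss_moment i j k l)"
    unfolding eq by (simp add: gauss_moment_def integrable_gauss_moment_fun)
  also have "\<dots> = (\<Sum>i\<in>UNIV. \<Sum>j\<in>UNIV. \<Sum>k\<in>UNIV. \<Sum>l\<in>UNIV.
      (if i = j then if k = l then E b $ i $ j * cnj (E c $ k $ l) else 0 else 0)
      + (if i = k then if j = l then E b $ i $ j * cnj (E c $ k $ l) else 0 else 0)) / (of_nat CARD('d) * (of_nat CARD('d) + 1))"
    unfolding gauss_moment_eq sum_divide_distrib by (intro sum.cong refl) (auto simp: add_divide_distrib)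
  also have "(\<Sum>i\<in>UNIV. \<Sum>j\<in>UNIV. \<Sum>k\<in>UNIV. \<Sum>l\<in>UNIV.
      (if i = j then if k = l then E b $ i $ j * cnj (E c $ k $ l) else 0 else 0)
      + (if i = k then if j = l then E b $ i $ j * cnj (E c $ k $ l) else 0 else 0))
    = trace (E b) * cnj (trace (E c)) + cnj (hs (E b) (E c))"
  proof -
    have push: "(\<Sum>x\<in>UNIV. if P then h x else 0) = (if P then \<Sum>x\<in>UNIV. h x else (0::complex))"
      for P and h :: "'d \<Rightarrow> complex" by simp
    show ?thesis
      by (simp add: sum.distrib push trace_def hs_sum sum_product)
  qed
  finally show "(\<integral>x. cnj (hs (E b) (pure_state x)) * hs (E c) (pure_state x) \<partial>gauss)
    = (cnj (hs (E b) (mat 1)) * hs (E c) (mat 1) + (if b = c then 1 else 0))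
       / (of_nat CARD('d) * (of_nat CARD('d) + 1))"
    by (simp add: hs_mat_1 hs_E)
qed

text \<open>The product of traces in the second moment reassembles, by \<open>hs_expansion\<close>,
  into the overlap at the identity matrix; the Kronecker delta leaves the diagonal sum.\<close>

lemma avg_fidelity_eq_hs:
  assumes "hp_linear \<Phi>" "hp_linear \<Psi>"
  shows "avg_fidelity \<Phi> \<Psi> = (hs (\<Phi> (mat 1)) (\<Psi> (mat 1)) + (\<Sum>b\<in>UNIV. hs (\<Phi> (E b)) (\<Psi> (E b))))
    / (of_nat CARD('d) * (of_nat CARD('d) + 1))"
proof -
  let ?D = "of_nat CARD('d) * (of_nat CARD('d) + 1) :: complex"
  have "avg_fidelity \<Phi> \<Psi> = (\<integral>x. hs (\<Phi> (pure_state x)) (\<Psi> (pure_state x)) \<partial>gauss)"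
    by (simp add: avg_fidelity_def hs_def)
  also have "\<dots> = (\<Sum>b\<in>UNIV. \<Sum>c\<in>UNIV. (\<integral>x. cnj (hs (E b) (pure_state x)) * hs (E c) (pure_state x) \<partial>gauss)
       * hs (\<Phi> (E b)) (\<Psi> (E c)))"
    by (simp add: hs_expansion[OF assms, of "pure_state x" for x] integrable_pure_state)
  also have "\<dots> = (\<Sum>b\<in>UNIV. \<Sum>c\<in>UNIV. cnj (hs (E b) (mat 1)) * hs (E c) (mat 1) * hs (\<Phi> (E b)) (\<Psi> (E c))
      + (if b = c then hs (\<Phi> (E b)) (\<Psi> (E c)) else 0)) / ?D"
    unfolding integral_pure_state sum_divide_distrib
    by (intro sum.cong refl) (auto simp: add_divide_distrib distrib_right)
  also have "\<dots> = (hs (\<Phi> (mat 1)) (\<Psi> (mat 1)) + (\<Sum>b\<in>UNIV. hs (\<Phi> (E b)) (\<Psi> (E b)))) / ?D"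
    by (simp add: hs_expansion[OF assms, of "mat 1"] sum.distrib)
  finally show ?thesis .
qed

lemma avg_fidelity_eq_fro_inner:
  assumes "hp_linear \<Phi>" "\<And>A. trace (\<Phi> A) = trace A"
    and "hp_linear \<Psi>" "\<And>c. \<Psi> (mat c) = mat c"
  shows "avg_fidelity \<Phi> \<Psi> = complex_of_real (1 / real CARD('d)
    + fro_inner (liou E \<Phi>) (liou E \<Psi> ** liou E Pi_tr) / (real CARD('d) * (real CARD('d) + 1)))"
proof -
  have D: "of_nat CARD('d) \<noteq> (0::complex)" "of_nat CARD('d) + 1 \<noteq> (0::complex)"
    by (simp, metis of_nat_Suc of_nat_eq_0_iff add.commute nat.distinct(1))
  \<comment> \<open>The term \<open>of_nat CARD('d)\<close> is the overlap of the images of the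
    identity, and the 1 restores what \<open>P\<close> removes. Together they cancel the factor d +
    1 and leave 1 / d.\<close>
  have "avg_fidelity \<Phi> \<Psi> = (of_nat CARD('d) + (1 + complex_of_real (fro_inner (liou E \<Phi>) (liou E \<Psi> ** liou E Pi_tr))))
    / (of_nat CARD('d) * (of_nat CARD('d) + 1))"
    by (subst fro_inner_liou_Pi_tr[OF assms])
      (simp_all add: avg_fidelity_eq_hs[OF assms(1,3)] assms hs_mat_1 trace_mat)
  also have "\<dots> = 1 / of_nat CARD('d) + complex_of_real (fro_inner (liou E \<Phi>) (liou E \<Psi> ** liou E Pi_tr))
    / (of_nat CARD('d) * (of_nat CARD('d) + 1))"
  proof -
    have "(of_nat CARD('d) + 1) / (of_nat CARD('d) * (of_nat CARD('d) + 1)) = 1 / (of_nat CARD('d) :: complex)"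
      using D(2) by simp
    then show ?thesis
      unfolding add.assoc[symmetric] by (subst add_divide_distrib) (simp only:)
  qed
  finally show ?thesis by simp
qed

abbreviation "P \<equiv> liou E Pi_tr"

lemma transpose_P: "transpose P = P"
  by (rule transpose_liou) (rule hs_Pi_tr)

lemma P_idem: "P ** P = P"
  by (simp add: liou_comp[symmetric] hp_linear_Pi_tr Pi_tr_idem)

lemma P_commute:
  assumes "unitary_channel g"
  shows "P ** liou E g = liou E g ** P"
  using assms by (simp add: liou_comp[symmetric] hp_linear_Pi_tr hp_linear_unitary_channel Pi_tr_unitary_channel)

text \<open>Taking \<open>id\<close> for both maps in \<open>fro_inner_liou_Pi_tr\<close> counts the
  basis, which has d^2 elements, less one.\<close>

lemma fro_norm_P: "(fro_norm P)\<^sup>2 = (real CARD('d))\<^sup>2 - 1"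
proof -
  have "complex_of_real (fro_inner (mat 1) (mat 1 ** P)) = complex_of_real (real CARD('b) - 1)"
    using fro_inner_liou_Pi_tr[of id id] by (simp add: hp_linear_id liou_id hs_E)
  then have "fro_inner (mat 1) P = real CARD('b) - 1"
    by (simp only: of_real_eq_iff matrix_mul_lid)
  then have "fro_inner P P = real CARD('b) - 1"
    by (simp add: fro_inner_def transpose_P P_idem)
  moreover have "real CARD('b) \<ge> 1"
    by (simp add: Suc_leI)
  ultimately show ?thesis
    by (simp add: fro_norm_def card_E)
qed

lemma transpose_liou_uchan: "transpose (liou E (uchan V)) = liou E (uchan (adj V))"
  by (rule transpose_liou) (rule hs_uchan)

lemma liou_cprod:
  assumes "\<forall>f\<in>set fs. hp_linear f"
  shows "liou E (cprod fs) = mprod (map (liou E) fs)"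
  using assms by (induction fs) (auto simp: liou_id liou_comp hp_linear_cprod)

end

section \<open>Averaged tensor powers and rank-one deflation\<close>

lemma expect_0: "expect G 0 f = f []"
  by (simp add: expect_def seqs_def cong: conj_cong)

text \<open>The last gate is split off, not the first, because \<open>mprod\<close> puts it
  leftmost, where it acts as one more factor of T.\<close>

lemma seqs_Suc: "seqs G (Suc m) = (\<lambda>(gs, g). gs @ [g]) ` (seqs G m \<times> G)"
proof (intro equalityI subsetI)
  fix xs assume "xs \<in> seqs G (Suc m)"
  then show "xs \<in> (\<lambda>(gs, g). gs @ [g]) ` (seqs G m \<times> G)"
    by (cases xs rule: rev_cases) (auto simp: seqs_def image_iff)
qed (auto simp: seqs_def)

lemma expect_Suc:
  "expect G (Suc m) f = (1 / real (card G)) *\<^sub>R (\<Sum>g\<in>G. expect G m (\<lambda>gs. f (gs @ [g])))"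
proof -
  have "inj_on (\<lambda>(gs, g). gs @ [g]) (seqs G m \<times> G)"
    by (auto simp: inj_on_def)
  then have "sum f (seqs G (Suc m)) = (\<Sum>g\<in>G. \<Sum>gs\<in>seqs G m. f (gs @ [g]))"
    unfolding seqs_Suc by (subst sum.reindex) (auto simp: sum.cartesian_product' case_prod_beta' sum.swap[of _ G])
  then show ?thesis
    by (simp add: expect_def scaleR_sum_right)
qed

lemma expect_1: "expect G 1 f = (1 / real (card G)) *\<^sub>R (\<Sum>g\<in>G. f [g])"
  using expect_Suc[of G 0 f] by (simp add: expect_0)

lemma linear_expect:
  assumes "linear h"
  shows "h (expect G m f) = expect G m (\<lambda>gs. h (f gs))"
  unfolding expect_def by (simp add: linear_scale[OF assms] linear_sum[OF assms])

lemma expect_cong: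
  assumes "\<And>gs. length gs = m \<Longrightarrow> set gs \<subseteq> G \<Longrightarrow> f gs = h gs"
  shows "expect G m f = expect G m h"
  unfolding expect_def seqs_def by (intro arg_cong[where f = "scaleR _"] sum.cong refl) (auto simp: assms)

lemma expect_affine:
  fixes f :: "'g list \<Rightarrow> real"
  assumes "finite G" "G \<noteq> {}"
  shows "expect G m (\<lambda>gs. complex_of_real (a + c * f gs)) = complex_of_real (a + c * expect G m f)"
proof -
  have "card (seqs G m) = card G ^ m"
    using card_lists_length_eq[OF assms(1), of m] by (simp add: seqs_def conj_commute)
  moreover have "card G \<noteq> 0" using assms by simp
  ultimately have 1: "expect G m (\<lambda>gs. a) = a"
    by (simp add: expect_def)
  have "expect G m (\<lambda>gs. complex_of_real (a + c * f gs)) = complex_of_real (expect G m (\<lambda>gs. a + c * f gs))"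
    by (rule linear_expect[symmetric]) (rule linearI; simp add: scaleR_conv_of_real)
  also have "expect G m (\<lambda>gs. a + c * f gs) = expect G m (\<lambda>gs. a) + c * expect G m f"
    by (simp add: expect_def sum.distrib distrib_left sum_distrib_left sum_divide_distrib mult_ac)
  finally show ?thesis by (simp add: 1)
qed

section \<open>Column stacking, Kronecker products and matrix powers\<close>

lemma vecm_inner: "vecm X \<bullet> vecm Y = fro_inner X Y"
proof -
  have "(\<Sum>p\<in>UNIV. X $ snd p $ fst p * Y $ snd p $ fst p) = (\<Sum>j\<in>UNIV. \<Sum>i\<in>UNIV. X $ i $ j * Y $ i $ j)"
    by (simp add: sum.cartesian_product case_prod_beta)
  then show ?thesis
    by (simp add: inner_vec_def vecm_def fro_inner_def trace_def transpose_def matrix_matrix_mult_def)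
qed

lemma norm_vecm: "norm (vecm X) = fro_norm X"
  by (simp add: norm_eq_sqrt_inner vecm_inner fro_norm_def)

lemma linear_vecm: "linear vecm"
  by (rule linearI) (simp_all add: vecm_def vec_eq_iff)

lemma linear_inner_vecm: "linear (\<lambda>Y. y \<bullet> vecm Y)"
  by (rule linearI) (simp_all add: linear_add[OF linear_vecm] linear_scale[OF linear_vecm] inner_add_right)

lemma vecm_surj: "\<exists>X. y = vecm X"
  by (rule exI[of _ "\<chi> i j. y $ (j, i)"]) (simp add: vecm_def vec_eq_iff)

lemma fro_inner_transpose: "fro_inner (transpose A) X = trace (A ** X)"
  by (simp add: fro_inner_def)

lemma fro_norm_transpose: "fro_norm (transpose A) = fro_norm A"
  unfolding fro_norm_def fro_inner_def by (subst trace_mul_sym) simp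

lemma kron_vecm: "kron C B *v vecm X = vecm (B ** X ** transpose C)"
proof -
  have "(kron C B *v vecm X) $ p = vecm (B ** X ** transpose C) $ p" for p
  proof -
    have "(kron C B *v vecm X) $ p
      = (\<Sum>a\<in>UNIV. \<Sum>b\<in>UNIV. C $ fst p $ a * B $ snd p $ b * X $ b $ a)"
      by (simp add: matrix_vector_mult_def kron_def vecm_def sum.cartesian_product case_prod_beta)
    also have "\<dots> = vecm (B ** X ** transpose C) $ p"
      by (simp add: vecm_def matrix_matrix_mult_def transpose_def sum_distrib_left sum_distrib_right mult_ac)
    finally show ?thesis .
  qed
  then show ?thesis by (simp add: vec_eq_iff)
qed

lemma mprod_snoc: "mprod (Xs @ [X]) = X ** mprod Xs"
  by (induction Xs) (simp_all add: matrix_mul_assoc)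

lemma mpow_Suc_right: "mpow A (Suc k) = mpow A k ** A"
  by (induction k) (simp_all add: matrix_mul_assoc)

lemma linear_matrix_vector: "linear (\<lambda>A. A *v (y :: real^'n::finite))"
  by (rule linearI) (simp_all add: matrix_vector_mult_add_rdistrib scaleR_matrix_vector_assoc)

lemma linear_matrix_conj: "linear (\<lambda>Y :: real^'n::finite^'n. B ** Y ** C)"
  by (rule linearI)
    (simp_all add: matrix_matrix_mult_def vec_eq_iff sum.distrib sum_distrib_left sum_distrib_right algebra_simps)

text \<open>The gates are independent, so averaging over the newest one is one application of
  \<open>T\<close>. The matrix \<open>X\<close> stays free because it will be \<open>P\<close> for
  B, arbitrary for A and \<open>U ** P\<close> for the fidelity.\<close>

lemma mpow_expect_kron:
  fixes L Lt :: "'g \<Rightarrow> real^'n::finite^'n"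
  assumes "T = expect G 1 (\<lambda>gs. kron (L (hd gs)) (Lt (hd gs)))"
  shows "mpow T m *v vecm X
    = vecm (expect G m (\<lambda>gs. mprod (map Lt gs) ** X ** transpose (mprod (map L gs))))"
proof (induction m)
  case 0
  show ?case by (simp add: expect_0)
next
  case (Suc m)
  let ?Y = "\<lambda>gs. mprod (map Lt gs) ** X ** transpose (mprod (map L gs))"
  have "mpow T (Suc m) *v vecm X = T *v vecm (expect G m ?Y)"
    by (simp add: matrix_vector_mul_assoc[symmetric] Suc)
  also have "\<dots> = (1 / real (card G)) *\<^sub>R (\<Sum>g\<in>G. kron (L g) (Lt g) *v vecm (expect G m ?Y))"
    unfolding assms expect_1
    by (simp add: linear_scale[OF linear_matrix_vector] linear_sum[OF linear_matrix_vector])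
  also have "\<dots> = (1 / real (card G)) *\<^sub>R (\<Sum>g\<in>G. vecm (expect G m (\<lambda>gs. ?Y (gs @ [g]))))"
    unfolding kron_vecm linear_expect[OF linear_matrix_conj]
    by (simp add: mprod_snoc matrix_transpose_mul matrix_mul_assoc)
  also have "\<dots> = vecm (expect G (Suc m) ?Y)"
    unfolding expect_Suc by (simp add: linear_scale[OF linear_vecm] linear_sum[OF linear_vecm])
  finally show ?case .
qed

lemma outer_mult: "outer x y *v z = (y \<bullet> z) *\<^sub>R x"
  by (simp add: outer_def matrix_vector_mult_def vec_eq_iff inner_vec_def sum_distrib_left sum_distrib_right mult_ac)

text \<open>The matrix \<open>outer \<beta> \<alpha>\<close> divided by
  \<open>\<alpha> \<bullet> \<beta>\<close> is an oblique projection that commutes with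
  \<open>T\<close>. \<open>\<Delta>\<close> is what remains of \<open>T\<close> on its
  kernel.\<close>

locale rank_one_deflation =
  fixes T \<Delta> :: "real^'n::finite^'n" and p :: real and \<alpha> \<beta> :: "real^'n"
  assumes right: "T *v \<beta> = p *\<^sub>R \<beta>"
    and left: "\<alpha> \<bullet> (T *v y) = p * (\<alpha> \<bullet> y)"
    and overlap: "\<alpha> \<bullet> \<beta> \<noteq> 0"
    and deflated: "\<Delta> = T - (p / (\<alpha> \<bullet> \<beta>)) *\<^sub>R outer \<beta> \<alpha>"
begin

lemma \<Delta>_mult: "\<Delta> *v z = T *v z - (p * (\<alpha> \<bullet> z) / (\<alpha> \<bullet> \<beta>)) *\<^sub>R \<beta>"
  by (simp add: deflated matrix_vector_mult_diff_rdistrib scaleR_matrix_vector_assoc[symmetric] outer_mult)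

lemma \<Delta>_right: "\<Delta> *v \<beta> = 0"
  using overlap by (simp add: \<Delta>_mult right)

lemma \<Delta>_left: "\<alpha> \<bullet> (\<Delta> *v z) = 0"
  using overlap by (simp add: \<Delta>_mult inner_diff_right left)

lemma mpow_\<Delta>_right: "m \<ge> 1 \<Longrightarrow> mpow \<Delta> m *v \<beta> = 0"
  by (cases m) (simp_all add: mpow_Suc_right matrix_vector_mul_assoc[symmetric] \<Delta>_right del: mpow.simps)

lemma mpow_\<Delta>_left: "m \<ge> 1 \<Longrightarrow> \<alpha> \<bullet> (mpow \<Delta> m *v z) = 0"
  by (cases m) (simp_all add: matrix_vector_mul_assoc[symmetric] \<Delta>_left)

text \<open>\<open>T\<close> and \<open>\<Delta>\<close> agree on vectors orthogonal to \<alpha>,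
  and the range of \<open>\<Delta>\<close> consists of such vectors. At \<open>m = 0\<close> the
  projection would be counted twice, since \<open>mpow \<Delta> 0\<close> is the identity.\<close>

lemma mpow_T:
  assumes "m \<ge> 1"
  shows "mpow T m *v y = (p ^ m * (\<alpha> \<bullet> y) / (\<alpha> \<bullet> \<beta>)) *\<^sub>R \<beta> + mpow \<Delta> m *v y"
  using assms
proof (induction m rule: dec_induct)
  case base
  show ?case by (simp add: \<Delta>_mult)
next
  case (step m)
  have "mpow T (Suc m) *v y = T *v (mpow T m *v y)"
    by (simp add: matrix_vector_mul_assoc)
  also have "\<dots> = (p ^ Suc m * (\<alpha> \<bullet> y) / (\<alpha> \<bullet> \<beta>)) *\<^sub>R \<beta> + T *v (mpow \<Delta> m *v y)"
    by (simp add: step matrix_vector_right_distrib matrix_vector_mult_scaleR right)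
  also have "T *v (mpow \<Delta> m *v y) = mpow \<Delta> (Suc m) *v y"
    using step(1) \<Delta>_mult[of "mpow \<Delta> m *v y"] mpow_\<Delta>_left[of m y]
    by (simp add: matrix_vector_mul_assoc)
  finally show ?case .
qed

end

text \<open>This recovers the defining equations of w and v from their solved form. If
  \<open>1 - a\<^sup>2\<close> is 0, the left side is 0 by convention, and so is the right side,
  whose squared norm is \<open>1 - a\<^sup>2\<close>.\<close>

lemma unit_residual:
  fixes x \<alpha> :: "'a::real_inner"
  assumes "norm x = 1" "\<alpha> \<noteq> 0" and a: "a = (\<alpha> \<bullet> x) / norm \<alpha>"
  shows "sqrt (1 - a\<^sup>2) *\<^sub>R inverse (sqrt (1 - a\<^sup>2)) *\<^sub>R (x - (a / norm \<alpha>) *\<^sub>R \<alpha>) = x - (a / norm \<alpha>) *\<^sub>R \<alpha>"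
proof (cases "1 - a\<^sup>2 = 0")
  case True
  have ax: "\<alpha> \<bullet> x = a * norm \<alpha>" using assms by simp
  have "(norm (x - (a / norm \<alpha>) *\<^sub>R \<alpha>))\<^sup>2 = (norm x)\<^sup>2 - 2 * (a / norm \<alpha>) * (\<alpha> \<bullet> x) + (a / norm \<alpha>)\<^sup>2 * (norm \<alpha>)\<^sup>2"
    unfolding power2_norm_eq_inner
    by (simp add: inner_diff_left inner_diff_right inner_commute power2_eq_square)
  also have "\<dots> = 1 - a\<^sup>2"
    using assms(2) by (simp add: ax assms(1) power_divide) (simp add: power2_eq_square)
  finally show ?thesis using True by simp
qed simp

section \<open>Fidelity of random circuits\<close>

lemma tendsto_linear:
  fixes h :: "'a::euclidean_space \<Rightarrow> 'b::real_normed_vector"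
  assumes "linear h" "(f \<longlongrightarrow> l) F"
  shows "((\<lambda>n. h (f n)) \<longlongrightarrow> h l) F"
  using assms by (simp add: bounded_linear.tendsto linear_conv_bounded_linear[symmetric])

text \<open>With K the ideal and M the projected circuit, cyclicity of the trace turns the overlap
  of the noisy circuit Z with the conjugated K into a form in \<open>U ** P\<close>, to which
  \<open>mpow_expect_kron\<close> applies. M can stand in for K because a factor \<open>P\<close> is
  always adjacent.\<close>

lemma fro_inner_conjugated_circuit:
  fixes P U K M Z :: "real^'n::finite^'n"
  assumes P: "transpose P = P" "P ** P = P" and PU: "P ** U = U ** P"
    and PK: "P ** K = K ** P" and PM: "P ** M = P ** K" "M ** P = P ** M"
  shows "fro_inner (U ** P) (Z ** (U ** P) ** transpose M)
    = fro_inner Z (U ** K ** transpose U ** P)"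
proof -
  have PMt: "P ** transpose M = transpose K ** P"
    using arg_cong[OF PM(2), of transpose] by (simp add: PM(1) matrix_transpose_mul P)
  have PKt: "P ** transpose K = transpose K ** P"
    using arg_cong[OF PK, of transpose] by (simp add: matrix_transpose_mul P)
  have "fro_inner (U ** P) (Z ** (U ** P) ** transpose M)
    = trace (P ** (transpose U ** Z ** U ** (P ** transpose M)))"
    by (simp add: fro_inner_def matrix_transpose_mul P matrix_mul_assoc)
  also have "\<dots> = trace (transpose U ** Z ** U ** transpose K ** (P ** P))"
    by (subst trace_mul_sym) (simp add: PMt matrix_mul_assoc)
  also have "\<dots> = trace ((transpose U ** Z ** U) ** (P ** transpose K))"
    by (simp add: P(2) PKt matrix_mul_assoc)
  also have "\<dots> = trace ((P ** transpose K) ** (transpose U ** Z ** U))"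
    by (rule trace_mul_sym)
  also have "\<dots> = trace ((P ** transpose K ** transpose U ** Z) ** U)"
    by (simp add: matrix_mul_assoc)
  also have "\<dots> = trace (U ** (P ** transpose K ** transpose U ** Z))"
    by (rule trace_mul_sym)
  also have "\<dots> = trace (transpose (transpose Z ** (U ** K ** transpose U ** P)))"
    by (simp add: matrix_transpose_mul P matrix_mul_assoc PU)
  also have "\<dots> = fro_inner Z (U ** K ** transpose U ** P)"
    unfolding fro_inner_def by (simp add: trace_def transpose_def)
  finally show ?thesis .
qed

lemma mprod_commute:
  assumes "\<forall>X\<in>set Xs. A ** X = X ** A"
  shows "A ** mprod Xs = mprod Xs ** A"
  using assms
proof (induction Xs)
  case (Cons X Xs)
  have IH: "A ** mprod Xs = mprod Xs ** A" using Cons by simp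
  have "A ** mprod (X # Xs) = A ** mprod Xs ** X"
    by (simp add: matrix_mul_assoc)
  also have "\<dots> = mprod Xs ** (A ** X)"
    by (simp add: IH matrix_mul_assoc)
  also have "\<dots> = mprod (X # Xs) ** A"
    using Cons.prems by (simp flip: matrix_mul_assoc)
  finally show ?case .
qed simp

text \<open>The copies of \<open>P\<close> inside the projected gates can be moved to the left and
  merged, as \<open>P\<close> is idempotent and commutes with each gate. The outer \<open>P\<close>
  makes the empty list fit.\<close>

lemma (in hermitian_basis) mprod_Ltr:
  assumes "\<forall>g\<in>set gs. unitary_channel g"
  shows "P ** mprod (map (liou E) gs) = mprod (map (liou E) gs) ** P"
    and "P ** mprod (map (Ltr E) gs) = P ** mprod (map (liou E) gs)"
    and "mprod (map (Ltr E) gs) ** P = P ** mprod (map (Ltr E) gs)"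
proof -
  have commute: "P ** liou E g = liou E g ** P" if "g \<in> set gs" for g
    using assms that by (intro P_commute) auto
  show K: "P ** mprod (map (liou E) gs) = mprod (map (liou E) gs) ** P"
    by (rule mprod_commute) (auto simp: commute)
  show "mprod (map (Ltr E) gs) ** P = P ** mprod (map (Ltr E) gs)"
    by (rule mprod_commute[symmetric]) (auto simp: Ltr_def matrix_mul_assoc commute)
  show "P ** mprod (map (Ltr E) gs) = P ** mprod (map (liou E) gs)"
    using commute
  proof (induction gs)
    case (Cons g gs)
    let ?K = "mprod (map (liou E) gs)"
    have K: "P ** ?K = ?K ** P"
      by (rule mprod_commute) (auto simp: Cons.prems)
    have "P ** mprod (map (Ltr E) (g # gs)) = P ** mprod (map (Ltr E) gs) ** (liou E g ** P)"
      by (simp add: Ltr_def matrix_mul_assoc)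
    also have "\<dots> = P ** ?K ** (P ** liou E g)"
      using Cons by simp
    also have "\<dots> = ?K ** (P ** P) ** liou E g"
      by (simp only: K matrix_mul_assoc)
    also have "\<dots> = P ** mprod (map (liou E) (g # gs))"
      by (simp add: P_idem K[symmetric] matrix_mul_assoc)
    finally show ?case .
  qed simp
qed

theorem theorem1:
  fixes G :: "(complex^'d^'d \<Rightarrow> complex^'d^'d) set"
    and Gt :: "(complex^'d^'d \<Rightarrow> complex^'d^'d) \<Rightarrow> (complex^'d^'d \<Rightarrow> complex^'d^'d)"
    and E :: "'b::finite \<Rightarrow> complex^'d^'d"
    and V :: "complex^'d^'d"
    and p :: real
    and Ainf Binf :: "real^'b^'b"
    and m :: nat
  assumes "finite_channel_group G"
    and "unitary_2design G"
    and "\<forall>g\<in>G. cptp (Gt g)"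
    and "herm_onb E"
    and "largest_eigenvalue (Tmat E G Gt) p"
    and "(\<lambda>n. (1 / p ^ n) *\<^sub>R Amat E G Gt n) \<longlonglongrightarrow> Ainf"
    and "(\<lambda>n. (1 / p ^ n) *\<^sub>R Bmat E G Gt n) \<longlonglongrightarrow> Binf"
    and "fro_inner (transpose Ainf) Binf \<noteq> 0"
    and "unitary_mat V"
    and "m \<ge> 1"
  shows "circuit_fidelity G Gt V m =
    complex_of_real (1 / real CARD('d) + (real CARD('d) - 1) / real CARD('d) *
      (Ccoef E Ainf Binf V * p ^ m + Dterm E (Tmat E G Gt) p Ainf Binf m V))"
proof -
  interpret hermitian_basis E by unfold_locales (rule assms)
  note Alim = assms(6) and Blim = assms(7)
  define Lt where "Lt = (\<lambda>g. liou E (Gt g))"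
  define T where "T = Tmat E G Gt"
  define U where "U = liou E (uchan V)"
  define v where "v = vecm (U ** P)"
  define \<alpha> where "\<alpha> = vecm (transpose Ainf)"
  define \<beta> where "\<beta> = vecm Binf"
  define \<Delta> where "\<Delta> = Delta T p Ainf Binf"
  define n where "n = fro_norm P"
  have G: "finite G" "G \<noteq> {}" and uc: "\<And>g. g \<in> G \<Longrightarrow> unitary_channel g"
    using assms(1) by (auto simp: finite_channel_group_def)
  have ucV: "unitary_channel (uchan V)"
    by (rule unitary_channel_uchan) (rule assms)
  have PU: "P ** U = U ** P"
    unfolding U_def by (rule P_commute[OF ucV])
  have U_orth: "transpose U ** U = mat 1"
  proof -
    have "uchan (adj V) \<circ> uchan V = id"
      using assms(9) by (simp add: fun_eq_iff uchan_def unitary_mat_def matrix_mul_assoc)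
        (simp add: unitary_mat_def flip: matrix_mul_assoc)
    then show ?thesis
      by (simp add: U_def transpose_liou_uchan hp_linear_uchan liou_id flip: liou_comp)
  qed
  have T_pow: "mpow T k *v vecm X
      = vecm (expect G k (\<lambda>gs. mprod (map Lt gs) ** X ** transpose (mprod (map (Ltr E) gs))))" for k X
    by (rule mpow_expect_kron) (simp add: T_def Tmat_def Lt_def)
  have Bmat_T: "vecm (Bmat E G Gt k) = mpow T k *v vecm P" for k
    unfolding T_pow Bmat_def Lt_def ..
  have lin_A: "linear (\<lambda>A. vecm (transpose A) \<bullet> (y :: real^('b \<times> 'b)))" for y
    by (rule linearI) (simp_all add: vecm_def transpose_def inner_vec_def sum.distrib sum_distrib_left algebra_simps)
  \<comment> \<open>The dual of \<open>Bmat_T\<close>: cyclicity of the trace moves the circuit onto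
    \<open>y\<close>. Stating it through inner products avoids the transpose of T.\<close>
  have Amat_T: "vecm (transpose (Amat E G Gt k)) \<bullet> y = vecm P \<bullet> (mpow T k *v y)" for k y
  proof -
    obtain X where y: "y = vecm X" using vecm_surj by blast
    show ?thesis
      unfolding y T_pow Amat_def linear_expect[OF lin_A] linear_expect[OF linear_inner_vecm]
    proof (rule expect_cong)
      fix gs
      show "vecm (transpose (transpose (mprod (map (Ltr E) gs)) ** P ** mprod (map (\<lambda>g. liou E (Gt g)) gs))) \<bullet> vecm X
        = vecm P \<bullet> vecm (mprod (map Lt gs) ** X ** transpose (mprod (map (Ltr E) gs)))"
        using trace_mul_sym[of "transpose (mprod (map (Ltr E) gs))" "P ** mprod (map Lt gs) ** X"]
        by (simp only: vecm_inner fro_inner_def transpose_transpose transpose_P Lt_def matrix_mul_assoc)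
    qed
  qed
  \<comment> \<open>For \<open>p = 0\<close>, division by zero makes every rescaled average with k
    >= 1 vanish, so the limit A would be 0 and its overlap with B as well.\<close>
  have "p \<noteq> 0"
  proof
    assume "p = 0"
    then have "\<forall>\<^sub>F k in sequentially. (1 / p ^ k) *\<^sub>R Amat E G Gt k = 0"
      by (intro eventually_sequentiallyI[of 1]) auto
    then have "Ainf = 0"
      by (intro LIMSEQ_unique[OF Alim] tendsto_eventually)
    then show False
      using assms(8) by (simp add: fro_inner_transpose trace_def matrix_matrix_mult_def)
  qed
  have A_lim: "(\<lambda>k. (1 / p ^ k) * (vecm P \<bullet> (mpow T k *v y))) \<longlonglongrightarrow> \<alpha> \<bullet> y" for y
    using tendsto_linear[OF lin_A Alim, of y] by (simp add: linear_scale[OF lin_A] Amat_T \<alpha>_def)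
  have left: "\<alpha> \<bullet> (T *v y) = p * (\<alpha> \<bullet> y)" for y
  proof (rule LIMSEQ_unique)
    show "(\<lambda>k. (1 / p ^ k) * (vecm P \<bullet> (mpow T k *v (T *v y)))) \<longlonglongrightarrow> \<alpha> \<bullet> (T *v y)"
      by (rule A_lim)
    have "(\<lambda>k. p * ((1 / p ^ Suc k) * (vecm P \<bullet> (mpow T (Suc k) *v y)))) \<longlonglongrightarrow> p * (\<alpha> \<bullet> y)"
      by (intro tendsto_mult tendsto_const LIMSEQ_Suc A_lim)
    then show "(\<lambda>k. (1 / p ^ k) * (vecm P \<bullet> (mpow T k *v (T *v y)))) \<longlonglongrightarrow> p * (\<alpha> \<bullet> y)"
      using \<open>p \<noteq> 0\<close> by (simp add: mpow_Suc_right matrix_vector_mul_assoc del: mpow.simps)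
  qed
  have B_lim: "(\<lambda>k. (1 / p ^ k) *\<^sub>R (mpow T k *v vecm P)) \<longlonglongrightarrow> \<beta>"
    using tendsto_linear[OF linear_vecm Blim] by (simp add: linear_scale[OF linear_vecm] Bmat_T \<beta>_def)
  have right: "T *v \<beta> = p *\<^sub>R \<beta>"
  proof (rule LIMSEQ_unique)
    show "(\<lambda>k. T *v ((1 / p ^ k) *\<^sub>R (mpow T k *v vecm P))) \<longlonglongrightarrow> T *v \<beta>"
      by (rule tendsto_linear[OF matrix_vector_mul_linear B_lim])
    have "(\<lambda>k. p *\<^sub>R ((1 / p ^ Suc k) *\<^sub>R (mpow T (Suc k) *v vecm P))) \<longlonglongrightarrow> p *\<^sub>R \<beta>"
      by (intro tendsto_scaleR tendsto_const LIMSEQ_Suc[OF B_lim])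
    then show "(\<lambda>k. T *v ((1 / p ^ k) *\<^sub>R (mpow T k *v vecm P))) \<longlonglongrightarrow> p *\<^sub>R \<beta>"
      using \<open>p \<noteq> 0\<close> by (simp add: matrix_vector_mult_scaleR matrix_vector_mul_assoc)
  qed
  have \<alpha>\<beta>: "\<alpha> \<bullet> \<beta> = fro_inner (transpose Ainf) Binf"
    by (simp add: \<alpha>_def \<beta>_def vecm_inner)
  have "\<Delta> = T - (p / (\<alpha> \<bullet> \<beta>)) *\<^sub>R outer \<beta> \<alpha>"
    unfolding \<Delta>_def Delta_def \<alpha>\<beta> unfolding \<alpha>_def \<beta>_def ..
  then interpret rank_one_deflation T \<Delta> p \<alpha> \<beta>
    by unfold_locales (simp_all add: right left \<alpha>\<beta> assms(8))
  have PM: "P ** transpose (mprod (map (Ltr E) gs)) = transpose (mprod (map (Ltr E) gs)) ** P"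
    if "set gs \<subseteq> G" for gs
    using arg_cong[OF mprod_Ltr(3)[of gs], of transpose] that uc
    by (auto simp: matrix_transpose_mul transpose_P)
  \<comment> \<open>Every average is fixed by \<open>P\<close> on the left, hence so is the limit.
    This and \<open>BP\<close> allow U in place of \<open>U ** P\<close> in the overlaps, as in the
    definitions of a, b and C.\<close>
  have PA: "P ** Ainf = Ainf"
  proof -
    have lin: "linear (\<lambda>A :: real^'b^'b. P ** A)" using linear_matrix_conj[of P "mat 1"] by simp
    have "P ** Amat E G Gt k = Amat E G Gt k" for k
      unfolding Amat_def linear_expect[OF lin]
    proof (rule expect_cong)
      fix gs assume "set gs \<subseteq> G"
      then have PM: "P ** transpose (mprod (map (Ltr E) gs)) = transpose (mprod (map (Ltr E) gs)) ** P"
        by (rule PM)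
      let ?Z = "mprod (map (\<lambda>g. liou E (Gt g)) gs)" and ?M = "transpose (mprod (map (Ltr E) gs))"
      have "P ** (?M ** P ** ?Z) = (P ** ?M) ** P ** ?Z"
        by (simp only: matrix_mul_assoc)
      also have "\<dots> = ?M ** (P ** P) ** ?Z"
        by (simp only: PM matrix_mul_assoc)
      finally show "P ** (?M ** P ** ?Z) = ?M ** P ** ?Z"
        by (simp only: P_idem)
    qed
    then have "(\<lambda>k. (1 / p ^ k) *\<^sub>R Amat E G Gt k) \<longlonglongrightarrow> P ** Ainf"
      using tendsto_linear[OF lin Alim] by (simp add: linear_scale[OF lin])
    then show ?thesis by (rule LIMSEQ_unique[OF _ Alim])
  qed
  have BP: "Binf ** P = Binf"
  proof -
    have lin: "linear (\<lambda>A :: real^'b^'b. A ** P)" using linear_matrix_conj[of "mat 1" P] by simp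
    have "Bmat E G Gt k ** P = Bmat E G Gt k" for k
      unfolding Bmat_def linear_expect[OF lin]
    proof (rule expect_cong)
      fix gs assume "set gs \<subseteq> G"
      then have PM: "P ** transpose (mprod (map (Ltr E) gs)) = transpose (mprod (map (Ltr E) gs)) ** P"
        by (rule PM)
      let ?Z = "mprod (map (\<lambda>g. liou E (Gt g)) gs)" and ?M = "transpose (mprod (map (Ltr E) gs))"
      have "?Z ** P ** ?M ** P = ?Z ** P ** (P ** ?M)"
        by (simp only: PM matrix_mul_assoc)
      also have "\<dots> = ?Z ** (P ** P) ** ?M"
        by (simp only: matrix_mul_assoc)
      finally show "?Z ** P ** ?M ** P = ?Z ** P ** ?M"
        by (simp only: P_idem)
    qed
    then have "(\<lambda>k. (1 / p ^ k) *\<^sub>R Bmat E G Gt k) \<longlonglongrightarrow> Binf ** P"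
      using tendsto_linear[OF lin Blim] by (simp add: linear_scale[OF lin])
    then show ?thesis by (rule LIMSEQ_unique[OF _ Blim])
  qed
  have \<alpha>v: "\<alpha> \<bullet> v = fro_inner (transpose Ainf) U"
  proof -
    have "\<alpha> \<bullet> v = trace ((Ainf ** U) ** P)"
      by (simp add: \<alpha>_def v_def vecm_inner fro_inner_transpose matrix_mul_assoc)
    also have "\<dots> = trace (P ** Ainf ** U)"
      by (subst trace_mul_sym) (simp add: matrix_mul_assoc)
    finally show ?thesis by (simp add: PA fro_inner_transpose)
  qed
  have v\<beta>: "v \<bullet> \<beta> = fro_inner U Binf"
  proof -
    have "v \<bullet> \<beta> = trace (P ** (transpose U ** Binf))"
      by (simp add: \<beta>_def v_def vecm_inner fro_inner_def matrix_transpose_mul transpose_P matrix_mul_assoc)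
    also have "\<dots> = trace (transpose U ** (Binf ** P))"
      by (subst trace_mul_sym) (simp add: matrix_mul_assoc)
    finally show ?thesis by (simp add: BP fro_inner_def)
  qed
  have "norm v = n"
  proof -
    have "transpose (U ** P) ** (U ** P) = P ** (transpose U ** U) ** P"
      by (simp add: matrix_transpose_mul transpose_P matrix_mul_assoc)
    then show ?thesis
      by (simp add: v_def norm_vecm n_def fro_norm_def fro_inner_def U_orth transpose_P)
  qed
  have "\<alpha> \<noteq> 0" "\<beta> \<noteq> 0" using overlap by auto
  \<comment> \<open>If \<open>P\<close> were 0, as happens for d = 1, then A =
    \<open>P ** Ainf\<close> would be 0, against the nonzero overlap.\<close>
  have "n > 0"
  proof -
    have "vecm P \<noteq> 0"
    proof
      assume "vecm P = 0"
      then have "P = 0" by (simp add: vecm_def vec_eq_iff)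
      then have "Ainf = 0" using PA by (simp add: matrix_matrix_mult_def vec_eq_iff)
      then show False using \<open>\<alpha> \<noteq> 0\<close> by (simp add: \<alpha>_def vecm_def transpose_def vec_eq_iff)
    qed
    then show ?thesis by (simp add: n_def flip: norm_vecm)
  qed
  define x where "x = (1 / n) *\<^sub>R v"
  have "norm x = 1" using \<open>norm v = n\<close> \<open>n > 0\<close> by (simp add: x_def)
  have nA: "fro_norm Ainf = norm \<alpha>" and nB: "fro_norm Binf = norm \<beta>"
    by (simp_all add: \<alpha>_def \<beta>_def norm_vecm fro_norm_transpose)
  have a: "acoef E Ainf V = (\<alpha> \<bullet> x) / norm \<alpha>"
    using \<open>n > 0\<close>
    by (simp add: acoef_def Let_def nA x_def \<alpha>v flip: U_def n_def) (simp add: real_sqrt_divide power2_eq_square)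
  have b: "bcoef E Binf V = (\<beta> \<bullet> x) / norm \<beta>"
    using \<open>n > 0\<close>
    by (simp add: bcoef_def Let_def nB x_def inner_commute[of \<beta>] v\<beta> flip: U_def n_def) (simp add: real_sqrt_divide power2_eq_square)
  have w: "sqrt (1 - (acoef E Ainf V)\<^sup>2) *\<^sub>R wvec E Ainf V = x - (acoef E Ainf V / norm \<alpha>) *\<^sub>R \<alpha>"
    using unit_residual[OF \<open>norm x = 1\<close> \<open>\<alpha> \<noteq> 0\<close> a]
    by (simp add: wvec_def Let_def nA x_def v_def \<alpha>_def[symmetric] flip: U_def n_def)
  have vv: "sqrt (1 - (bcoef E Binf V)\<^sup>2) *\<^sub>R vvec E Binf V = x - (bcoef E Binf V / norm \<beta>) *\<^sub>R \<beta>"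
    using unit_residual[OF \<open>norm x = 1\<close> \<open>\<beta> \<noteq> 0\<close> b]
    by (simp add: vvec_def Let_def nB x_def v_def \<beta>_def[symmetric] flip: U_def n_def)
  have "Dterm E T p Ainf Binf m V
    = (sqrt (1 - (acoef E Ainf V)\<^sup>2) *\<^sub>R wvec E Ainf V) \<bullet> (mpow \<Delta> m *v (sqrt (1 - (bcoef E Binf V)\<^sup>2) *\<^sub>R vvec E Binf V))"
    by (simp add: Dterm_def \<Delta>_def matrix_vector_mult_scaleR)
  \<comment> \<open>In the residuals w and v, the parts along \<alpha> and \<beta> are annihilated
    by the power of \<open>\<Delta>\<close> from the left and from the right. Both residuals may
    thus be replaced by \<open>x\<close>.\<close>
  also have "\<dots> = x \<bullet> (mpow \<Delta> m *v x)"
    unfolding w vv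
    by (simp add: matrix_vector_mult_diff_distrib matrix_vector_mult_scaleR mpow_\<Delta>_right[OF assms(10)]
        inner_diff_left mpow_\<Delta>_left[OF assms(10)])
  also have "\<dots> = (v \<bullet> (mpow \<Delta> m *v v)) / n\<^sup>2"
    by (simp add: x_def matrix_vector_mult_scaleR power2_eq_square)
  finally have D: "n\<^sup>2 * Dterm E T p Ainf Binf m V = v \<bullet> (mpow \<Delta> m *v v)"
    using \<open>n > 0\<close> by simp
  have C: "n\<^sup>2 * Ccoef E Ainf Binf V = (\<alpha> \<bullet> v) * (v \<bullet> \<beta>) / (\<alpha> \<bullet> \<beta>)"
    using \<open>n > 0\<close> by (simp add: Ccoef_def Let_def \<alpha>v v\<beta> \<alpha>\<beta> flip: U_def n_def)
  have vTv: "v \<bullet> (mpow T m *v v) = n\<^sup>2 * (Ccoef E Ainf Binf V * p ^ m + Dterm E T p Ainf Binf m V)"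
    unfolding distrib_left mult.assoc[symmetric] C D
    by (simp add: mpow_T[OF assms(10), of v] inner_add_right)

  have twirl: "expect G m (\<lambda>gs. fro_inner (mprod (map Lt gs)) (U ** mprod (map (liou E) gs) ** transpose U ** P))
     = v \<bullet> (mpow T m *v v)"
  proof -
    show ?thesis
      unfolding v_def T_pow linear_expect[OF linear_inner_vecm] unfolding vecm_inner
    proof (rule expect_cong)
      fix gs assume "set gs \<subseteq> G"
      then have "\<forall>g\<in>set gs. unitary_channel g" using uc by auto
      from mprod_Ltr[OF this] show "fro_inner (mprod (map Lt gs)) (U ** mprod (map (liou E) gs) ** transpose U ** P)
        = fro_inner (U ** P) (mprod (map Lt gs) ** (U ** P) ** transpose (mprod (map (Ltr E) gs)))"
        by (intro fro_inner_conjugated_circuit[symmetric] transpose_P P_idem PU)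
    qed
  qed
  have fid: "avg_fidelity (cprod (map Gt gs)) (uchan V \<circ> cprod gs \<circ> uchan (adj V))
      = complex_of_real (1 / real CARD('d) + 1 / (real CARD('d) * (real CARD('d) + 1))
         * fro_inner (mprod (map Lt gs)) (U ** mprod (map (liou E) gs) ** transpose U ** P))"
    if "set gs \<subseteq> G" for gs
  proof -
    have ug: "\<forall>g\<in>set gs. unitary_channel g" and cg: "\<forall>f\<in>set (map Gt gs). cptp f"
      using that uc assms(3) by auto
    have ucV': "unitary_channel (uchan (adj V))"
      by (intro unitary_channel_uchan unitary_mat_adj assms)
    have hp: "hp_linear (cprod gs)" "hp_linear (uchan V)" "hp_linear (uchan (adj V))"
      using cprod_unitary_channel(1)[OF ug] by (auto simp: hp_linear_uchan)
    have "liou E (cprod gs) = mprod (map (liou E) gs)"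
      using liou_cprod[of gs] ug by (simp add: hp_linear_unitary_channel)
    then have "liou E (uchan V \<circ> cprod gs \<circ> uchan (adj V)) = U ** mprod (map (liou E) gs) ** transpose U"
      by (simp add: liou_comp hp hp_linear_comp U_def transpose_liou_uchan)
    moreover have "liou E (cprod (map Gt gs)) = mprod (map Lt gs)"
      using liou_cprod[of "map Gt gs"] cg by (simp add: hp_linear_cptp Lt_def comp_def)
    ultimately show ?thesis
      by (subst avg_fidelity_eq_fro_inner)
        (auto simp: cprod_cptp[OF cg] hp hp_linear_comp unitary_channel_mat[OF ucV] unitary_channel_mat[OF ucV']
          cprod_unitary_channel[OF ug])
  qed
  have "circuit_fidelity G Gt V m = complex_of_real (1 / real CARD('d)
      + 1 / (real CARD('d) * (real CARD('d) + 1)) * (v \<bullet> (mpow T m *v v)))"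
    unfolding circuit_fidelity_def twirl[symmetric] expect_affine[OF G, symmetric]
    by (rule expect_cong) (rule fid)
  also have "1 / (real CARD('d) * (real CARD('d) + 1)) * (v \<bullet> (mpow T m *v v))
    = (real CARD('d) - 1) / real CARD('d) * (Ccoef E Ainf Binf V * p ^ m + Dterm E T p Ainf Binf m V)"
  \<comment> \<open>The squared norm d^2 - 1 = (d - 1) (d + 1) cancels the factor d + 1 of the
    second moment.\<close>
  proof -
    have "n\<^sup>2 = (real CARD('d) - 1) * (real CARD('d) + 1)"
      unfolding n_def fro_norm_P by (simp add: algebra_simps power2_eq_square)
    then show ?thesis unfolding vTv by (simp add: add_nonneg_eq_0_iff)
  qed
  finally show ?thesis by (simp only: T_def)
qed

end
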